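(* Let $\phi$ be a finite-range repulsive pair potential on $\mathbb{R}^d$ and let $\lambda>0$ be such that the family of Gibbs point processes defined by $\phi$ exhibits strong spatial mixing with activities bounded by $\lambda$. Then for every unit vector $\vec u\in\mathbb{S}^{d-1}$, $$p(\lambda)=\rho_{\boldsymbol{\lambda}_{\vec u}}(0),$$ where $\boldsymbol{\lambda}_{\vec u}(x)=\lambda\mathbf 1\{\langle\vec u,x\rangle\ge0\}$.
   Context: Pair potential $\phi$ (symmetric, $\phi\ge 0$, $\phi(x)=0$ for $\|x\|>r$), $H(x_1,\dots,x_k)=\sum_{i<j}\phi(x_i-x_j)$, partition function $Z(\boldsymbol{\lambda})$ and Gibbs measure $\mu_{\boldsymbol{\lambda}}$ for a bounded, boundedly supported activity function $\boldsymbol{\lambda}\ge0$ are as usual: $Z(\boldsymbol{\lambda})=1+\sum_{k\ge1}\frac1{k!}\int\prod_i\boldsymbol{\lambda}(x_i)e^{-H}dx$ and $\mu_{\boldsymbol{\lambda}}$ has density $\prod_i\boldsymbol{\lambda}(x_i)e^{-H}/Z(\boldsymbol{\lambda})$ w.r.t. the unit-intensity Poisson process (with the $1/k!$ convention). Strong spatial mixing with activities bounded by $\lambda$ means: there exist $\alpha,\beta>0$ such that for all bounded measurable $\Lambda$ and activity functions $\boldsymbol{\lambda},\boldsymbol{\lambda}'\le\lambda$, the total variation distance between the laws of $\mu_{\boldsymbol{\lambda}}$ and $\mu_{\boldsymbol{\lambda}'}$ restricted to $\Lambda$ is at most $\alpha|\Lambda|e^{-\beta\,\mathrm{dist}(\Lambda,\supp(\boldsymbol{\lambda}-\boldsymbol{\lambda}'))}$.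 The one-point density is $\rho_{\boldsymbol{\lambda}}(v)=\boldsymbol{\lambda}(v)\mathbb{E}_{\mu_{\boldsymbol{\lambda}}}e^{-H_v(\mathbf X)}$ with $H_v(\mathbf X)=\sum_{x\in\mathbf X}\phi(v-x)$; for $\boldsymbol{\lambda}$ without bounded support, $\rho_{\boldsymbol{\lambda}}(v)=\lim_{n\to\infty}\rho_{\boldsymbol{\lambda}\mathbf 1_{B_n}}(v)$ (which exists under strong spatial mixing), $B_n$ the ball of radius $n$ at the origin. For constant $\lambda$ and bounded $\Lambda$, $Z_\Lambda(\lambda)=Z(\lambda\mathbf 1_\Lambda)$. The pressure is $p(\lambda)=\lim_{n\to\infty}|\Lambda_n|^{-1}\log Z_{\Lambda_n}(\lambda)$ with $\Lambda_n=[-n,n]^d$. *)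

theory Defs
  imports "HOL-Analysis.Analysis"
begin

text \<open>Points live in a Euclidean space 'a (R^d). A pair potential is
  phi :: 'a => ereal with values in [0, +infinity] (hard cores allowed).
  Boltzmann factor exp(-phi x), with exp(-infinity) = 0.\<close>

definition boltz :: "('a::euclidean_space \<Rightarrow> ereal) \<Rightarrow> 'a \<Rightarrow> real" where
  "boltz \<phi> x = (if \<phi> x = \<infinity> then 0 else exp (- real_of_ereal (\<phi> x)))"

definition weight :: "('a::euclidean_space \<Rightarrow> ereal) \<Rightarrow> ('a \<Rightarrow> real) \<Rightarrow> nat \<Rightarrow> (nat \<Rightarrow> 'a) \<Rightarrow> real" where
  "weight \<phi> lam k x = (\<Prod>i<k. lam (x i)) * (\<Prod>i<k. \<Prod>j\<in>{i<..<k}. boltz \<phi> (x i - x j))"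

abbreviation kspace :: "nat \<Rightarrow> (nat \<Rightarrow> 'a::euclidean_space) measure" where
  "kspace k \<equiv> PiM {..<k} (\<lambda>_. lborel)"

definition gibbs_Z :: "('a::euclidean_space \<Rightarrow> ereal) \<Rightarrow> ('a \<Rightarrow> real) \<Rightarrow> real" where
  "gibbs_Z \<phi> lam = (\<Sum>k. (1 / fact k) * integral\<^sup>L (kspace k) (weight \<phi> lam k))"

text \<open>Unnormalised expectation of exp(-H_v(X)), H_v(X) = sum_{x in X} phi(v - x).\<close>
definition gibbs_EZ :: "('a::euclidean_space \<Rightarrow> ereal) \<Rightarrow> ('a \<Rightarrow> real) \<Rightarrow> 'a \<Rightarrow> real" where
  "gibbs_EZ \<phi> lam v = (\<Sum>k. (1 / fact k) *
      integral\<^sup>L (kspace k) (\<lambda>x. weight \<phi> lam k x * (\<Prod>i<k. boltz \<phi> (v - x i))))"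

text \<open>One-point density rho_lam(v) = lam(v) E_{mu_lam} exp(-H_v(X)).\<close>
definition rho :: "('a::euclidean_space \<Rightarrow> ereal) \<Rightarrow> ('a \<Rightarrow> real) \<Rightarrow> 'a \<Rightarrow> real" where
  "rho \<phi> lam v = lam v * gibbs_EZ \<phi> lam v / gibbs_Z \<phi> lam"

definition activity :: "('a::euclidean_space \<Rightarrow> real) \<Rightarrow> bool" where
  "activity lam \<longleftrightarrow> lam \<in> borel_measurable borel \<and> (\<forall>x. 0 \<le> lam x)
     \<and> bounded (range lam) \<and> bounded {x. lam x \<noteq> 0}"

definition cat_config :: "nat \<Rightarrow> (nat \<Rightarrow> 'a) \<Rightarrow> (nat \<Rightarrow> 'a) \<Rightarrow> nat \<Rightarrow> 'a" where
  "cat_config k x y = (\<lambda>i. if i < k then x i else y (i - k))"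

text \<open>Janossy density of the restriction of mu_lam to Lambda: density (w.r.t.
  (1/k!) Lebesgue measure on Lambda^k) that the configuration inside Lambda is
  exactly {x_0,..,x_{k-1}}.\<close>
definition janossy :: "('a::euclidean_space \<Rightarrow> ereal) \<Rightarrow> ('a \<Rightarrow> real) \<Rightarrow> 'a set \<Rightarrow> nat \<Rightarrow> (nat \<Rightarrow> 'a) \<Rightarrow> real" where
  "janossy \<phi> lam \<Lambda> k x =
     (\<Sum>m. (1 / fact m) * integral\<^sup>L (kspace m)
        (\<lambda>y. weight \<phi> lam (k + m) (cat_config k x y) * (\<Prod>j<m. indicator (- \<Lambda>) (y j))))
     / gibbs_Z \<phi> lam"

text \<open>Total variation distance between the laws of mu_lam and mu_lam' restricted
  to Lambda (half the L1 distance of the Janossy densities).\<close>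
definition tv_restr :: "('a::euclidean_space \<Rightarrow> ereal) \<Rightarrow> ('a \<Rightarrow> real) \<Rightarrow> ('a \<Rightarrow> real) \<Rightarrow> 'a set \<Rightarrow> real" where
  "tv_restr \<phi> lam lam' \<Lambda> = (1 / 2) * (\<Sum>k. (1 / fact k) * integral\<^sup>L (kspace k)
      (\<lambda>x. (\<Prod>i<k. indicator \<Lambda> (x i)) * \<bar>janossy \<phi> lam \<Lambda> k x - janossy \<phi> lam' \<Lambda> k x\<bar>))"

definition strong_spatial_mixing :: "('a::euclidean_space \<Rightarrow> ereal) \<Rightarrow> real \<Rightarrow> bool" where
  "strong_spatial_mixing \<phi> l \<longleftrightarrow>
     (\<exists>\<alpha>>0. \<exists>\<beta>>0. \<forall>\<Lambda> lam lam'.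
        \<Lambda> \<in> sets lborel \<and> bounded \<Lambda> \<and> activity lam \<and> activity lam'
        \<and> (\<forall>x. lam x \<le> l) \<and> (\<forall>x. lam' x \<le> l) \<longrightarrow>
        tv_restr \<phi> lam lam' \<Lambda>
          \<le> \<alpha> * measure lborel \<Lambda> * exp (- \<beta> * setdist \<Lambda> {x. lam x \<noteq> lam' x}))"

definition box_n :: "nat \<Rightarrow> 'a::euclidean_space set" where
  "box_n n = cbox (- (real n *\<^sub>R One)) (real n *\<^sub>R One)"

definition pressure_seq :: "('a::euclidean_space \<Rightarrow> ereal) \<Rightarrow> real \<Rightarrow> nat \<Rightarrow> real" where
  "pressure_seq \<phi> l n =
     ln (gibbs_Z \<phi> (\<lambda>x. l * indicator (box_n n :: 'a set) x)) / measure lborel (box_n n :: 'a set)"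

definition pressure :: "('a::euclidean_space \<Rightarrow> ereal) \<Rightarrow> real \<Rightarrow> real" where
  "pressure \<phi> l = lim (pressure_seq \<phi> l)"

definition repulsive_finite_range :: "('a::euclidean_space \<Rightarrow> ereal) \<Rightarrow> bool" where
  "repulsive_finite_range \<phi> \<longleftrightarrow> \<phi> \<in> borel_measurable borel \<and> (\<forall>x. 0 \<le> \<phi> x)
     \<and> (\<forall>x. \<phi> (- x) = \<phi> x) \<and> (\<exists>r. \<forall>x. norm x > r \<longrightarrow> \<phi> x = 0)"

end

(*
  Let E be the limit of E_mu exp(-H_0) for the half-space activities, so that the claim is p = l * E.
  Slice the box orthogonally to u into thin slabs and remove them one after the other. Removing a slab S
  from the bottom of the domain A \<union> S changes ln Z by the integral over S of l * E_{mu_A} exp(-H_x), up to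
  O(|S|^2), since configurations with two or more points in S are negligible. Seen from a point x of S far
  from the boundary of the box, A is locally a half space with x (almost) on its boundary, so by strong
  spatial mixing and translation invariance the integrand is close to l * E. Summing over the slabs gives
  ln Z = l * E * |box| + o(|box|).

  Strong spatial mixing bounds the difference of expectations because exp(-H_x) depends only on the points
  within the range of the potential, whose law has the Janossy densities; this marginalisation, like the
  expansion in the number of points in S, is a splitting of the Poisson process into two regions.
*)
theory Submission
  imports Defs
begin

text \<open>The statement speaks of real series and Bochner integrals, while the analysis runs in
  \<open>ennreal\<close>, where splitting and reordering ask for measurability only. The two are
  identified once each for \<open>gibbs_Z\<close>, \<open>janossy\<close> and
  \<open>tv_restr\<close>, by exponential bounds that come from repulsion: dropping Boltzmann
  factors only increases a weight. The key algebraic fact is that a test point v can be absorbed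
  into the activity. Expectations of exp(-H_v) are therefore ratios of partition functions, and one
  estimate for enlarging a domain serves both ln Z and these expectations. Two scales are chosen in
  order. The distance R from the boundary depends only on the accuracy. The slab width 1/N is chosen
  after the box: the second-order errors add up to the order of slab volume times box volume, and
  the slab volume grows with the box. As x lies in the slab itself, the domain seen from x is a half
  space shifted by up to 1/N; the gap is filled inside a ball of radius R at small cost. Convergence
  of the pressure comes out of the same estimate, without subadditivity.\<close>

subsection \<open>Poisson sums\<close>

text \<open>One condition for each length, over the product spaces of \<open>gibbs_Z\<close>, takes
  the place of a sigma-algebra on lists.\<close>

definition list_measurable :: "('a::euclidean_space list \<Rightarrow> 'b::topological_space) \<Rightarrow> bool" where
  "list_measurable F \<longleftrightarrow> (\<forall>k. (\<lambda>x. F (map x [0..<k])) \<in> borel_measurable (kspace k))"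

definition tuple_integral :: "nat \<Rightarrow> ('a::euclidean_space list \<Rightarrow> ennreal) \<Rightarrow> ennreal" where
  "tuple_integral k F = (\<integral>\<^sup>+x. F (map x [0..<k]) \<partial>kspace k)"

text \<open>Configurations are encoded as lists, so that restriction to two complementary regions becomes
  concatenation. Up to normalisation this is the expectation under the unit-intensity Poisson process.\<close>
definition poisson_sum :: "('a::euclidean_space list \<Rightarrow> ennreal) \<Rightarrow> ennreal" where
  "poisson_sum F = (\<Sum>k. ennreal (1 / fact k) * tuple_integral k F)"

text \<open>The list reads only the coordinates below k, so \<open>g w\<close> may be replaced by
  its restriction, which lies in the extensional product space.\<close>

lemma list_measurableD:
  assumes "list_measurable F" "\<And>i. i < k \<Longrightarrow> (\<lambda>w. g w i) \<in> borel_measurable N"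
  shows "(\<lambda>w. F (map (g w) [0..<k])) \<in> borel_measurable N"
proof -
  have "(\<lambda>w. \<lambda>i\<in>{..<k}. g w i) \<in> measurable N (kspace k)"
    using assms(2) by (intro measurable_restrict) auto
  moreover have "(\<lambda>x. F (map x [0..<k])) \<in> borel_measurable (kspace k)"
    using assms(1) by (simp add: list_measurable_def)
  ultimately have "(\<lambda>w. F (map (\<lambda>i\<in>{..<k}. g w i) [0..<k])) \<in> borel_measurable N"
    by (rule measurable_compose)
  moreover have "map (\<lambda>i\<in>{..<k}. g w i) [0..<k] = map (g w) [0..<k]" for w
    by (rule map_cong) auto
  ultimately show ?thesis by simp
qed

lemma kspace_coord: "i < k \<Longrightarrow> (\<lambda>x. x i) \<in> borel_measurable (kspace k)"
  using measurable_component_singleton[of i "{..<k}" "\<lambda>_. lborel"] by simp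

text \<open>The index shift in \<open>cat_config\<close> becomes concatenation of lists, which links
  \<open>janossy\<close> to the list encoding.\<close>

lemma map_cat_config: "map (cat_config k x y) [0..<k + m] = map x [0..<k] @ map y [0..<m]"
  by (rule nth_equalityI) (auto simp: cat_config_def nth_append)

lemma list_measurable_append:
  assumes "list_measurable F" "\<And>i. i < k \<Longrightarrow> (\<lambda>w. f w i) \<in> borel_measurable N"
    "\<And>i. i < m \<Longrightarrow> (\<lambda>w. g w i) \<in> borel_measurable N"
  shows "(\<lambda>w. F (map (f w) [0..<k] @ map (g w) [0..<m])) \<in> borel_measurable N"
proof -
  have "(\<lambda>w. F (map (cat_config k (f w) (g w)) [0..<k+m])) \<in> borel_measurable N"
  proof (intro list_measurableD[OF assms(1)])
    fix i assume "i < k + m"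
    then show "(\<lambda>w. cat_config k (f w) (g w) i) \<in> borel_measurable N"
      using assms(2)[of i] assms(3)[of "i - k"] by (cases "i < k") (simp_all add: cat_config_def)
  qed
  then show ?thesis by (simp only: map_cat_config)
qed

text \<open>The shape met in \<open>split_integral_step\<close>: a block inside the region, a block
  outside, and a new last point.\<close>

lemma list_measurable_append3:
  assumes "list_measurable F" "\<And>i. i < k \<Longrightarrow> (\<lambda>w. f w i) \<in> borel_measurable N"
    "\<And>i. i < m \<Longrightarrow> (\<lambda>w. g w i) \<in> borel_measurable N"
    "h \<in> borel_measurable N"
  shows "(\<lambda>w. F (map (f w) [0..<k] @ map (g w) [0..<m] @ [h w])) \<in> borel_measurable N"
proof -
  \<comment> \<open>The new point becomes entry m of the second block, which reduces the claim to
    two blocks.\<close>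
  have eq: "map ((g w)(m := h w)) [0..<m+1] = map (g w) [0..<m] @ [h w]" for w
    by (auto intro!: map_cong)
  have "(\<lambda>w. F (map (f w) [0..<k] @ map ((g w)(m := h w)) [0..<m+1])) \<in> borel_measurable N"
  proof (intro list_measurable_append assms)
    fix i assume "i < m + 1"
    then show "(\<lambda>w. ((g w)(m := h w)) i) \<in> borel_measurable N"
      using assms(3)[of i] assms(4) by (cases "i = m") simp_all
  qed
  then show ?thesis by (simp only: eq)
qed

lemma list_measurable_append2:
  assumes "list_measurable F" "\<And>i. i < k \<Longrightarrow> (\<lambda>w. f w i) \<in> borel_measurable N"
    "h \<in> borel_measurable N"
  shows "(\<lambda>w. F (map (f w) [0..<k] @ [h w])) \<in> borel_measurable N"
  using list_measurable_append3[of F k f N 0 "\<lambda>_ _. 0" h] assms by simp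

lemma list_measurable_times:
  fixes F G :: "'a::euclidean_space list \<Rightarrow> ennreal"
  shows "list_measurable F \<Longrightarrow> list_measurable G \<Longrightarrow> list_measurable (\<lambda>xs. F xs * G xs)"
  by (simp add: list_measurable_def borel_measurable_times_ennreal)

lemma list_measurable_append_left: "list_measurable F \<Longrightarrow> list_measurable (\<lambda>ys. F (map x [0..<k] @ ys))"
  unfolding list_measurable_def[of "\<lambda>ys. F (map x [0..<k] @ ys)"]
  using list_measurable_append[of F k "\<lambda>_. x" _ _ "\<lambda>w. w"] by auto

lemma list_measurable_snoc: "list_measurable F \<Longrightarrow> list_measurable (\<lambda>ys. F (ys @ [v]))"
  unfolding list_measurable_def[of "\<lambda>ys. F (ys @ [v])"]
  using list_measurable_append2[of F _ "\<lambda>w. w" _ "\<lambda>_. v"] by auto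

lemma list_measurable_indicator:
  assumes [measurable]: "A \<in> sets borel"
  shows "list_measurable (\<lambda>xs. indicator (lists A) xs :: ennreal)"
  unfolding list_measurable_def
proof
  fix k
  have "(\<lambda>x. \<Prod>i<k. indicator A (x i) :: ennreal) \<in> borel_measurable (kspace k)"
    by measurable
  moreover have "(\<Prod>i<k. indicator A (x i) :: ennreal) = indicator (lists A) (map x [0..<k])" for x
    by (induction k) (auto simp: indicator_def)
  ultimately show "(\<lambda>x. indicator (lists A) (map x [0..<k]) :: ennreal) \<in> borel_measurable (kspace k)"
    by simp
qed

section \<open>Integrals over tuples\<close>

lemma sigma_finite_kspace: "sigma_finite_measure (kspace k)"
proof -
  interpret product_sigma_finite "\<lambda>_::nat. lborel :: 'a measure" ..
  interpret finite_product_sigma_finite "\<lambda>_::nat. lborel :: 'a measure" "{..<k}" by standard auto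
  show ?thesis by unfold_locales
qed

lemma tuple_integral_measurable:
  assumes "\<And>k. (\<lambda>(w, x). F w (map x [0..<k])) \<in> borel_measurable (N \<Otimes>\<^sub>M kspace k)"
  shows "(\<lambda>w. tuple_integral k (F w)) \<in> borel_measurable N"
proof -
  interpret sigma_finite_measure "kspace k" by (rule sigma_finite_kspace)
  show ?thesis unfolding tuple_integral_def using assms[of k] by measurable
qed

lemma list_measurable_tuple_integral_append:
  assumes F: "list_measurable F" and g[measurable]: "list_measurable g"
  shows "list_measurable (\<lambda>xs. tuple_integral m (\<lambda>ys. g ys * F (xs @ ys)))"
  unfolding list_measurable_def
proof
  fix k
  interpret sigma_finite_measure "kspace m :: (nat \<Rightarrow> 'a) measure" by (rule sigma_finite_kspace)
  have "(\<lambda>w. F (map (fst w) [0..<k] @ map (snd w) [0..<m])) \<in> borel_measurable (kspace k \<Otimes>\<^sub>M kspace m)"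
    by (intro list_measurable_append F measurable_compose[OF measurable_fst] 
        measurable_compose[OF measurable_snd] kspace_coord)
  moreover have "(\<lambda>w. g (map (snd w) [0..<m])) \<in> borel_measurable (kspace k \<Otimes>\<^sub>M kspace m)"
    by (intro list_measurableD g measurable_compose[OF measurable_snd] kspace_coord)
  ultimately show "(\<lambda>x. tuple_integral m (\<lambda>ys. g ys * F (map x [0..<k] @ ys))) \<in> borel_measurable (kspace k)"
    unfolding tuple_integral_def by (intro borel_measurable_nn_integral) (unfold case_prod_beta', intro borel_measurable_times_ennreal)
qed

lemma tuple_integral_0 [simp]: "tuple_integral 0 F = F []"
proof -
  interpret product_sigma_finite "\<lambda>_::nat. lborel :: 'a measure" ..
  show ?thesis unfolding tuple_integral_def by (simp add: nn_integral_empty space_PiM_empty)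
qed

text \<open>The coordinate split off is the last one, since \<open>[0..<Suc k]\<close> grows at its
  end; the inductions on the length therefore append a point instead of prepending it.\<close>

lemma tuple_integral_Suc:
  assumes "list_measurable F"
  shows "tuple_integral (Suc k) F = (\<integral>\<^sup>+v. tuple_integral k (\<lambda>xs. F (xs @ [v])) \<partial>lborel)"
proof -
  interpret product_sigma_finite "\<lambda>_::nat. lborel :: 'a measure" ..
  have eq: "map (x(k := v)) [0..<Suc k] = map x [0..<k] @ [v]" for x and v :: 'a
    by auto
  have "tuple_integral (Suc k) F = (\<integral>\<^sup>+x. F (map x [0..<Suc k]) \<partial>PiM (insert k {..<k}) (\<lambda>_. lborel))"
    unfolding tuple_integral_def by (simp add: lessThan_Suc)
  also have "\<dots> = (\<integral>\<^sup>+v. \<integral>\<^sup>+x. F (map (x(k := v)) [0..<Suc k]) \<partial>kspace k \<partial>lborel)"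
    using assms
    by (intro product_nn_integral_insert_rev) (simp_all only: list_measurable_def lessThan_Suc[symmetric], simp_all)
  also have "\<dots> = (\<integral>\<^sup>+v. tuple_integral k (\<lambda>xs. F (xs @ [v])) \<partial>lborel)"
    unfolding eq tuple_integral_def ..
  finally show ?thesis .
qed

lemma tuple_integral_swap:
  assumes "(\<lambda>(x, v). G v (map x [0..<k])) \<in> borel_measurable (kspace k \<Otimes>\<^sub>M lborel)"
  shows "(\<integral>\<^sup>+v. tuple_integral k (G v) \<partial>lborel) = tuple_integral k (\<lambda>xs. \<integral>\<^sup>+v. G v xs \<partial>lborel)"
proof -
  interpret K: sigma_finite_measure "kspace k" by (rule sigma_finite_kspace)
  interpret pair_sigma_finite "kspace k" lborel ..
  show ?thesis unfolding tuple_integral_def using Fubini'[of "\<lambda>x v. G v (map x [0..<k])"] assms by simp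
qed

lemma tuple_integral_cong: "(\<And>xs. F xs = G xs) \<Longrightarrow> tuple_integral k F = tuple_integral k G"
  by (simp add: tuple_integral_def)

section \<open>Splitting a tuple between a region and its complement\<close>

definition split_integral :: "'a::euclidean_space set \<Rightarrow> ('a list \<Rightarrow> ennreal) \<Rightarrow> nat \<Rightarrow> nat \<Rightarrow> ennreal" where
  "split_integral A F k m = tuple_integral k (\<lambda>xs. indicator (lists A) xs * tuple_integral m (\<lambda>ys. indicator (lists (-A)) ys * F (xs @ ys)))"

definition perm_invariant :: "('a list \<Rightarrow> 'b) \<Rightarrow> bool" where
  "perm_invariant F \<longleftrightarrow> (\<forall>xs ys. mset xs = mset ys \<longrightarrow> F xs = F ys)"

lemma split_integral_snoc_measurable:
  assumes F: "list_measurable F" and A: "A \<in> sets borel"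
  shows "(\<lambda>v. split_integral A (\<lambda>xs. F (xs @ [v])) k m) \<in> borel_measurable borel"
proof -
  have A': "-A \<in> sets borel" using A by auto
  interpret M: sigma_finite_measure "kspace m" by (rule sigma_finite_kspace)
  have "(\<lambda>w. F (map (snd (fst w)) [0..<k] @ map (snd w) [0..<m] @ [fst (fst w)])) \<in> borel_measurable ((borel \<Otimes>\<^sub>M kspace k) \<Otimes>\<^sub>M kspace m)" for k
    by (intro list_measurable_append3 F measurable_compose[OF measurable_snd] kspace_coord)
       (auto intro!: measurable_compose[OF measurable_fst] measurable_compose[OF measurable_snd] kspace_coord)
  moreover have "(\<lambda>w. indicator (lists (-A)) (map (snd w) [0..<m]) :: ennreal) \<in> borel_measurable ((borel \<Otimes>\<^sub>M kspace k) \<Otimes>\<^sub>M kspace m)" for k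
    by (intro list_measurableD[OF list_measurable_indicator] A' measurable_compose[OF measurable_snd] kspace_coord)
  ultimately have [measurable]: "(\<lambda>w. tuple_integral m (\<lambda>ys. indicator (lists (-A)) ys * F (map (snd w) [0..<k] @ ys @ [fst w]))) \<in> borel_measurable (borel \<Otimes>\<^sub>M kspace k)" for k
    unfolding tuple_integral_def by (intro M.borel_measurable_nn_integral) (unfold case_prod_beta', intro borel_measurable_times_ennreal)
  have [measurable]: "(\<lambda>w. indicator (lists A) (map (snd w) [0..<k]) :: ennreal) \<in> borel_measurable (borel \<Otimes>\<^sub>M kspace k)" for k
    by (intro list_measurableD[OF list_measurable_indicator] A measurable_compose[OF measurable_snd] kspace_coord)
  show ?thesis
    unfolding split_integral_def by (rule tuple_integral_measurable) (simp add: case_prod_beta')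
qed

text \<open>Pascal's rule at the level of integrals: the new point v either lies in A and joins the
  first block or lies outside and joins the second.\<close>

lemma split_integral_step:
  assumes F: "list_measurable F" "perm_invariant F" and A: "A \<in> sets borel"
  shows "(\<integral>\<^sup>+v. split_integral A (\<lambda>xs. F (xs @ [v])) k m \<partial>lborel) = split_integral A F (Suc k) m + split_integral A F k (Suc m)"
proof -
  have A': "-A \<in> sets borel" using A by auto
  note [measurable] = A A'
  let ?J = "\<lambda>v xs. tuple_integral m (\<lambda>ys. indicator (lists (-A)) ys * F (xs @ ys @ [v]))"
  interpret K: sigma_finite_measure "kspace k" by (rule sigma_finite_kspace)
  interpret M: sigma_finite_measure "kspace m" by (rule sigma_finite_kspace)
  have mJ: "(\<lambda>w. ?J (snd w) (map (fst w) [0..<k])) \<in> borel_measurable (kspace k \<Otimes>\<^sub>M lborel)"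
  proof -
    have "(\<lambda>w. F (map (fst (fst w)) [0..<k] @ map (snd w) [0..<m] @ [snd (fst w)])) \<in> borel_measurable ((kspace k \<Otimes>\<^sub>M lborel) \<Otimes>\<^sub>M kspace m)"
      by (intro list_measurable_append3 F measurable_compose[OF measurable_snd] kspace_coord)
         (auto intro!: measurable_compose[OF measurable_fst] measurable_compose[OF measurable_snd] kspace_coord)
    moreover have "(\<lambda>w. indicator (lists (-A)) (map (snd w) [0..<m]) :: ennreal) \<in> borel_measurable ((kspace k \<Otimes>\<^sub>M lborel) \<Otimes>\<^sub>M kspace m)"
      by (intro list_measurableD[OF list_measurable_indicator] A' measurable_compose[OF measurable_snd] kspace_coord)
    ultimately show ?thesis
      unfolding tuple_integral_def by (intro M.borel_measurable_nn_integral) (unfold case_prod_beta', intro borel_measurable_times_ennreal)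
  qed
  have mIA: "(\<lambda>w. indicator (lists A) (map (fst w) [0..<k]) :: ennreal) \<in> borel_measurable (kspace k \<Otimes>\<^sub>M lborel)"
    by (intro list_measurableD[OF list_measurable_indicator] A measurable_compose[OF measurable_fst] kspace_coord)
  note [measurable] = mJ mIA
  have mX: "(\<lambda>v. tuple_integral k (\<lambda>xs. indicator (lists A) xs * ?J v xs)) \<in> borel_measurable lborel"
    using split_integral_snoc_measurable[OF F(1) A, of k m] by (simp add: split_integral_def)
  have "(\<integral>\<^sup>+v. split_integral A (\<lambda>xs. F (xs @ [v])) k m \<partial>lborel)
      = (\<integral>\<^sup>+v. tuple_integral k (\<lambda>xs. indicator (lists A) xs * ?J v xs) \<partial>lborel)"
    unfolding split_integral_def by simp
  also have "\<dots> = (\<integral>\<^sup>+v. indicator A v * tuple_integral k (\<lambda>xs. indicator (lists A) xs * ?J v xs)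
          + indicator (-A) v * tuple_integral k (\<lambda>xs. indicator (lists A) xs * ?J v xs) \<partial>lborel)"
    by (intro nn_integral_cong) (auto simp: indicator_def)
  also have "\<dots> = (\<integral>\<^sup>+v. indicator A v * tuple_integral k (\<lambda>xs. indicator (lists A) xs * ?J v xs) \<partial>lborel)
          + (\<integral>\<^sup>+v. indicator (-A) v * tuple_integral k (\<lambda>xs. indicator (lists A) xs * ?J v xs) \<partial>lborel)"
    by (intro nn_integral_add borel_measurable_times_ennreal mX) auto
  also have "(\<integral>\<^sup>+v. indicator A v * tuple_integral k (\<lambda>xs. indicator (lists A) xs * ?J v xs) \<partial>lborel) = split_integral A F (Suc k) m"
  proof -
    \<comment> \<open>Symmetry of F enters here: v moves past \<open>ys\<close> to the end of the
      first block.\<close>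
    have eq: "F (xs @ ys @ [v]) = F ((xs @ [v]) @ ys)" for xs ys v
      using F(2)[unfolded perm_invariant_def, rule_format, of "xs @ ys @ [v]" "(xs @ [v]) @ ys"] by simp
    have "split_integral A F (Suc k) m = (\<integral>\<^sup>+v. tuple_integral k (\<lambda>xs. indicator (lists A) (xs@[v]) * tuple_integral m (\<lambda>ys. indicator (lists (-A)) ys * F ((xs @ [v]) @ ys))) \<partial>lborel)"
      unfolding split_integral_def
      by (intro tuple_integral_Suc list_measurable_times list_measurable_indicator list_measurable_tuple_integral_append F A A')
    also have "\<dots> = (\<integral>\<^sup>+v. indicator A v * tuple_integral k (\<lambda>xs. indicator (lists A) xs * ?J v xs) \<partial>lborel)"
      unfolding eq by (intro nn_integral_cong) (auto simp: indicator_def tuple_integral_def)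
    finally show ?thesis by simp
  qed
  also have "(\<integral>\<^sup>+v. indicator (-A) v * tuple_integral k (\<lambda>xs. indicator (lists A) xs * ?J v xs) \<partial>lborel) = split_integral A F k (Suc m)"
  proof -
    have "(\<integral>\<^sup>+v. indicator (-A) v * tuple_integral k (\<lambda>xs. indicator (lists A) xs * ?J v xs) \<partial>lborel)
       = (\<integral>\<^sup>+v. tuple_integral k (\<lambda>xs. indicator (-A) v * (indicator (lists A) xs * ?J v xs)) \<partial>lborel)"
      by (intro nn_integral_cong) (auto simp: indicator_def tuple_integral_def)
    \<comment> \<open>The integral over v goes inside the one over \<open>xs\<close>, where v can
      become the last entry of the second block.\<close>
    also have "\<dots> = tuple_integral k (\<lambda>xs. \<integral>\<^sup>+v. indicator (-A) v * (indicator (lists A) xs * ?J v xs) \<partial>lborel)"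
      by (intro tuple_integral_swap) (simp add: case_prod_beta')
    also have "\<dots> = split_integral A F k (Suc m)"
      unfolding split_integral_def tuple_integral_def[of k]
    proof (intro nn_integral_cong)
      fix x :: "nat \<Rightarrow> 'a"
      let ?xs = "map x [0..<k]"
      have "tuple_integral (Suc m) (\<lambda>ys. indicator (lists (-A)) ys * F (?xs @ ys)) =
         (\<integral>\<^sup>+v. tuple_integral m (\<lambda>ys. indicator (lists (-A)) (ys@[v]) * F (?xs @ ys @ [v])) \<partial>lborel)"
        by (intro tuple_integral_Suc list_measurable_times list_measurable_indicator list_measurable_append_left F A')
      also have "\<dots> = (\<integral>\<^sup>+v. indicator (-A) v * ?J v ?xs \<partial>lborel)"
        by (intro nn_integral_cong) (auto simp: indicator_def tuple_integral_def)
      finally show "(\<integral>\<^sup>+v. indicator (-A) v * (indicator (lists A) ?xs * ?J v ?xs) \<partial>lborel)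
         = indicator (lists A) ?xs * tuple_integral (Suc m) (\<lambda>ys. indicator (lists (-A)) ys * F (?xs @ ys))"
        by (simp add: indicator_def)
    qed
    finally show ?thesis .
  qed
  finally show ?thesis .
qed

lemma list_measurable_split_integral_inner:
  assumes "list_measurable F" "A \<in> sets borel"
  shows "list_measurable (\<lambda>xs. tuple_integral m (\<lambda>ys. indicator (lists (-A)) ys * F (xs @ ys)))"
    "list_measurable (\<lambda>xs. indicator (lists A) xs * tuple_integral m (\<lambda>ys. indicator (lists (-A)) ys * F (xs @ ys)))"
proof -
  have "-A \<in> sets borel" using assms(2) by auto
  then show *: "list_measurable (\<lambda>xs. tuple_integral m (\<lambda>ys. indicator (lists (-A)) ys * F (xs @ ys)))"
    by (intro list_measurable_tuple_integral_append list_measurable_indicator assms(1))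
  show "list_measurable (\<lambda>xs. indicator (lists A) xs * tuple_integral m (\<lambda>ys. indicator (lists (-A)) ys * F (xs @ ys)))"
    by (intro list_measurable_times * list_measurable_indicator assms(2))
qed

lemma perm_invariant_snoc: "perm_invariant F \<Longrightarrow> perm_invariant (\<lambda>xs. F (xs @ [v]))"
  unfolding perm_invariant_def by simp

text \<open>By symmetry each of the n choose k placements of the points in A contributes the same.
  \<open>F\<close> stays arbitrary in the induction because the last point is absorbed into
  it.\<close>

lemma tuple_integral_split:
  assumes "list_measurable F" "perm_invariant F" and A: "A \<in> sets borel"
  shows "tuple_integral n F = (\<Sum>k\<le>n. of_nat (n choose k) * split_integral A F k (n - k))"
  using assms(1,2)
proof (induction n arbitrary: F)
  case 0
  then show ?case by (simp add: split_integral_def)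
next
  case (Suc n)
  let ?T = "split_integral A F"
  have "tuple_integral (Suc n) F = (\<integral>\<^sup>+v. tuple_integral n (\<lambda>xs. F (xs @ [v])) \<partial>lborel)"
    by (rule tuple_integral_Suc[OF Suc.prems(1)])
  also have "\<dots> = (\<integral>\<^sup>+v. (\<Sum>k\<le>n. of_nat (n choose k) * split_integral A (\<lambda>xs. F (xs @ [v])) k (n - k)) \<partial>lborel)"
    by (intro nn_integral_cong Suc.IH list_measurable_snoc perm_invariant_snoc Suc.prems)
  also have "\<dots> = (\<Sum>k\<le>n. of_nat (n choose k) * (\<integral>\<^sup>+v. split_integral A (\<lambda>xs. F (xs @ [v])) k (n - k) \<partial>lborel))"
    using split_integral_snoc_measurable[OF Suc.prems(1) A]
    by (subst nn_integral_sum) (auto intro!: sum.cong nn_integral_cmult borel_measurable_times_ennreal)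
  also have "\<dots> = (\<Sum>k\<le>n. of_nat (n choose k) * ?T (Suc k) (n - k)) + (\<Sum>k\<le>n. of_nat (n choose k) * ?T k (Suc n - k))"
    by (simp add: split_integral_step[OF Suc.prems A] distrib_left sum.distrib Suc_diff_le)
  \<comment> \<open>The added term k = Suc n vanishes with its binomial coefficient.\<close>
  also have "(\<Sum>k\<le>n. of_nat (n choose k) * ?T k (Suc n - k)) = (\<Sum>k\<le>Suc n. of_nat (n choose k) * ?T k (Suc n - k))"
    by simp
  also have "\<dots> = ?T 0 (Suc n) + (\<Sum>k\<le>n. of_nat (n choose Suc k) * ?T (Suc k) (n - k))"
    by (subst sum.atMost_Suc_shift) simp
  also have "(\<Sum>k\<le>n. of_nat (n choose k) * ?T (Suc k) (n - k)) + \<dots>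
     = (\<Sum>k\<le>Suc n. of_nat (Suc n choose k) * ?T k (Suc n - k))"
    by (subst sum.atMost_Suc_shift) (simp add: distrib_right sum.distrib algebra_simps)
  finally show ?case .
qed

lemma suminf_swap_ennreal: "(\<Sum>i. \<Sum>j. f i j) = (\<Sum>j. \<Sum>i. f i j :: ennreal)" for f :: "nat \<Rightarrow> nat \<Rightarrow> ennreal"
  using nn_integral_suminf[of "\<lambda>j i. f i j" "count_space UNIV"] by (simp add: nn_integral_count_space_nat)

text \<open>Exchanges summation by the total number of points for separate summation over the
  numbers inside and outside; nonnegativity alone justifies it.\<close>

lemma suminf_triangle_ennreal:
  fixes a :: "nat \<Rightarrow> nat \<Rightarrow> ennreal"
  shows "(\<Sum>n. \<Sum>k\<le>n. a k (n - k)) = (\<Sum>k. \<Sum>m. a k m)"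
proof -
  have "(\<Sum>n. \<Sum>k\<le>n. a k (n - k)) = (\<Sum>n. \<Sum>k. if k \<le> n then a k (n - k) else 0)"
    by (intro suminf_cong, subst suminf_finite[of "{..n}" for n]) auto
  also have "\<dots> = (\<Sum>k. \<Sum>n. if k \<le> n then a k (n - k) else 0)"
    by (rule suminf_swap_ennreal)
  also have "\<dots> = (\<Sum>k. \<Sum>m. a k m)"
  proof (rule suminf_cong)
    fix k
    show "(\<Sum>n. if k \<le> n then a k (n - k) else 0) = (\<Sum>m. a k m)"
      using suminf_offset[of "\<lambda>n. if k \<le> n then a k (n - k) else 0" k] by simp
  qed
  finally show ?thesis .
qed

lemma poisson_sum_cmult: "c * poisson_sum F = poisson_sum (\<lambda>xs. c * F xs)" if "list_measurable F"
  unfolding poisson_sum_def tuple_integral_def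
  using that by (subst ennreal_suminf_cmult[symmetric], subst nn_integral_cmult)
     (auto simp: list_measurable_def mult_ac)

lemma list_measurable_poisson_sum_append:
  assumes F: "list_measurable F" and g: "list_measurable g"
  shows "list_measurable (\<lambda>xs. poisson_sum (\<lambda>ys. g ys * F (xs @ ys)))"
  using list_measurable_tuple_integral_append[OF F g]
  unfolding list_measurable_def poisson_sum_def by (auto intro!: borel_measurable_suminf_order borel_measurable_times_ennreal)

text \<open>Independence of the restrictions of a Poisson process to A and to its complement.\<close>
lemma poisson_sum_split:
  assumes F: "list_measurable F" "perm_invariant F" and A: "A \<in> sets borel"
  shows "poisson_sum F = poisson_sum (\<lambda>xs. indicator (lists A) xs * poisson_sum (\<lambda>ys. indicator (lists (-A)) ys * F (xs @ ys)))"
proof -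
  have "poisson_sum F = (\<Sum>n. ennreal (1 / fact n) * (\<Sum>k\<le>n. of_nat (n choose k) * split_integral A F k (n - k)))"
    unfolding poisson_sum_def tuple_integral_split[OF F A] ..
  also have "\<dots> = (\<Sum>n. \<Sum>k\<le>n. ennreal (1 / fact k) * (ennreal (1 / fact (n - k)) * split_integral A F k (n - k)))"
  proof (intro suminf_cong, unfold sum_distrib_left, intro sum.cong refl)
    fix n k :: nat assume "k \<in> {..n}"
    \<comment> \<open>The factorials of \<open>poisson_sum\<close> are what makes the weights
      factorise over the two regions.\<close>
    then have "(1 / fact n) * real (n choose k) = (1 / fact k) * (1 / fact (n - k))"
      by (simp add: binomial_fact)
    then have "ennreal (1 / fact n) * of_nat (n choose k) = ennreal (1 / fact k) * ennreal (1 / fact (n - k))"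
      by (simp add: ennreal_of_nat_eq_real_of_nat ennreal_mult[symmetric])
    then show "ennreal (1 / fact n) * (of_nat (n choose k) * split_integral A F k (n - k)) =
       ennreal (1 / fact k) * (ennreal (1 / fact (n - k)) * split_integral A F k (n - k))"
      by (metis mult.assoc)
  qed
  also have "\<dots> = (\<Sum>k. \<Sum>m. ennreal (1 / fact k) * (ennreal (1 / fact m) * split_integral A F k m))"
    by (rule suminf_triangle_ennreal)
  also have "\<dots> = (\<Sum>k. ennreal (1 / fact k) * (\<Sum>m. ennreal (1 / fact m) * split_integral A F k m))"
    by simp
  also have "\<dots> = poisson_sum (\<lambda>xs. indicator (lists A) xs * poisson_sum (\<lambda>ys. indicator (lists (-A)) ys * F (xs @ ys)))"
  proof -
    have "(\<Sum>m. ennreal (1 / fact m) * split_integral A F k m)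
      = tuple_integral k (\<lambda>xs. indicator (lists A) xs * poisson_sum (\<lambda>ys. indicator (lists (-A)) ys * F (xs @ ys)))" for k
    proof -
      let ?J = "\<lambda>m xs. indicator (lists A) xs * tuple_integral m (\<lambda>ys. indicator (lists (-A)) ys * F (xs @ ys))"
      have m2: "(\<lambda>x. ?J m (map x [0..<k])) \<in> borel_measurable (kspace k)" for m
        using list_measurable_split_integral_inner(2)[OF F(1) A] unfolding list_measurable_def by blast
      have m3: "(\<lambda>x. ennreal (1 / fact m) * ?J m (map x [0..<k])) \<in> borel_measurable (kspace k)" for m
        by (rule borel_measurable_times_ennreal[OF borel_measurable_const m2])
      have "(\<Sum>m. ennreal (1 / fact m) * split_integral A F k m) = (\<Sum>m. tuple_integral k (\<lambda>xs. ennreal (1 / fact m) * (indicator (lists A) xs * tuple_integral m (\<lambda>ys. indicator (lists (-A)) ys * F (xs @ ys)))))"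
        unfolding split_integral_def tuple_integral_def[of k]
        using list_measurable_split_integral_inner(2)[OF F(1) A]
        by (intro suminf_cong nn_integral_cmult[symmetric]) (auto simp: list_measurable_def)
      also have "\<dots> = tuple_integral k (\<lambda>xs. \<Sum>m. ennreal (1 / fact m) * (indicator (lists A) xs * tuple_integral m (\<lambda>ys. indicator (lists (-A)) ys * F (xs @ ys))))"
        unfolding tuple_integral_def[of k] by (rule nn_integral_suminf[OF m3, symmetric])
      also have "\<dots> = tuple_integral k (\<lambda>xs. indicator (lists A) xs * poisson_sum (\<lambda>ys. indicator (lists (-A)) ys * F (xs @ ys)))"
        unfolding poisson_sum_def by (intro tuple_integral_cong) (subst ennreal_suminf_cmult[symmetric], intro suminf_cong mult.left_commute)
      finally show ?thesis .
    qed
    then show ?thesis unfolding poisson_sum_def[of "\<lambda>xs. indicator (lists A) xs * _ xs"] by simp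
  qed
  finally show ?thesis .
qed

section \<open>Translations, products and real series\<close>

lemma poisson_sum_mono: "(\<And>xs. F xs \<le> G xs) \<Longrightarrow> poisson_sum F \<le> poisson_sum G"
  unfolding poisson_sum_def tuple_integral_def by (intro suminf_le mult_left_mono nn_integral_mono) auto

lemma tuple_integral_translate:
  assumes "list_measurable F"
  shows "tuple_integral n (\<lambda>xs. F (map (\<lambda>x. x + c) xs)) = tuple_integral n F"
  using assms
proof (induction n arbitrary: F)
  case (Suc n)
  have T: "list_measurable (\<lambda>xs. F (map (\<lambda>x. x + c) xs))"
    unfolding list_measurable_def
  proof
    fix k
    have "(\<lambda>x. F (map (\<lambda>i. x i + c) [0..<k])) \<in> borel_measurable (kspace k)"
      by (rule list_measurableD[OF Suc.prems]) measurable
    then show "(\<lambda>x. F (map (\<lambda>x. x + c) (map x [0..<k]))) \<in> borel_measurable (kspace k)"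
      by (simp add: comp_def)
  qed
  let ?g = "\<lambda>v. tuple_integral n (\<lambda>xs. F (xs @ [v]))"
  have g: "?g \<in> borel_measurable borel"
  proof (rule tuple_integral_measurable)
    fix k show "(\<lambda>(w, x). F (map x [0..<k] @ [w])) \<in> borel_measurable (borel \<Otimes>\<^sub>M kspace k)"
      using list_measurable_append2[OF Suc.prems, of k snd "borel \<Otimes>\<^sub>M kspace k" fst]
      by (auto simp: case_prod_beta' intro: measurable_compose[OF measurable_snd])
  qed
  have "tuple_integral (Suc n) (\<lambda>xs. F (map (\<lambda>x. x + c) xs)) = (\<integral>\<^sup>+v. tuple_integral n (\<lambda>xs. F (map (\<lambda>x. x + c) xs @ [v + c])) \<partial>lborel)"
    using tuple_integral_Suc[OF T] by simp
  also have "\<dots> = (\<integral>\<^sup>+v. ?g (c + v) \<partial>lborel)"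
    using Suc.IH[OF list_measurable_snoc[OF Suc.prems]] by (simp add: add.commute)
  also have "\<dots> = (\<integral>\<^sup>+v. ?g v \<partial>distr lborel borel ((+) c))"
    using g by (simp add: nn_integral_distr)
  also have "\<dots> = tuple_integral (Suc n) F"
    unfolding tuple_integral_Suc[OF Suc.prems] lborel_distr_plus ..
  finally show ?case .
qed simp

lemma poisson_sum_translate: "list_measurable F \<Longrightarrow> poisson_sum (\<lambda>xs. F (map (\<lambda>x. x + c) xs)) = poisson_sum F"
  unfolding poisson_sum_def by (simp add: tuple_integral_translate)

lemma list_measurable_prod_list:
  fixes g :: "'a::euclidean_space \<Rightarrow> 'b::{second_countable_topology,real_normed_algebra_1,comm_monoid_mult}"
  assumes "g \<in> borel_measurable borel"
  shows "list_measurable (\<lambda>xs. \<Prod>x\<leftarrow>xs. g x)"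
  unfolding list_measurable_def
proof
  fix k
  \<comment> \<open>The product space stays fixed while the length j of the prefix grows, as the
    induction requires.\<close>
  have "(\<lambda>x. \<Prod>x\<leftarrow>map x [0..<j]. g x) \<in> borel_measurable (kspace k)" if "j \<le> k" for j
    using that
  proof (induction j)
    case (Suc j)
    have "(\<lambda>x. g (x j)) \<in> borel_measurable (kspace k)"
      using Suc.prems by (intro measurable_compose[OF kspace_coord assms]) auto
    with Suc show ?case by (auto intro!: borel_measurable_times)
  qed simp
  then show "(\<lambda>x. \<Prod>x\<leftarrow>map x [0..<k]. g x) \<in> borel_measurable (kspace k)" by blast
qed

lemma prod_list_nonneg': "(\<And>x. 0 \<le> g x) \<Longrightarrow> 0 \<le> (\<Prod>x\<leftarrow>xs. g x :: real)"
  by (induction xs) auto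

lemma indicator_lists: "indicator (lists A) xs = (\<Prod>x\<leftarrow>xs. indicator A x :: 'b::comm_semiring_1)"
proof (induction xs)
  case (Cons a xs)
  have "indicator (lists A) (a # xs) = (indicator A a * indicator (lists A) xs :: 'b)"
    by (simp add: indicator_def)
  then show ?case by (simp only: Cons.IH list.map prod_list.Cons)
qed simp

lemma list_measurable_ennreal: "list_measurable f \<Longrightarrow> list_measurable (\<lambda>xs. ennreal (f xs))"
  unfolding list_measurable_def using measurable_compose[OF _ measurable_ennreal] by blast

lemma tuple_integral_cmult: "list_measurable F \<Longrightarrow> tuple_integral k (\<lambda>xs. c * F xs) = c * tuple_integral k F"
  unfolding tuple_integral_def by (intro nn_integral_cmult) (auto simp: list_measurable_def)

lemma tuple_integral_mono: "(\<And>xs. F xs \<le> G xs) \<Longrightarrow> tuple_integral k F \<le> tuple_integral k G"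
  unfolding tuple_integral_def by (intro nn_integral_mono) auto

text \<open>The value without interaction. Together with bounds by products of activities it
  supplies the exponential bounds that \<open>poisson_sum_eq_series\<close> asks for.\<close>

lemma tuple_integral_prod_list:
  fixes g :: "'a::euclidean_space \<Rightarrow> real"
  assumes [measurable]: "g \<in> borel_measurable borel" and nn: "\<And>x. 0 \<le> g x"
  shows "tuple_integral k (\<lambda>xs. ennreal (\<Prod>x\<leftarrow>xs. g x)) = (\<integral>\<^sup>+x. g x \<partial>lborel) ^ k"
proof (induction k)
  case (Suc k)
  have m: "list_measurable (\<lambda>xs. ennreal (\<Prod>x\<leftarrow>xs. g x))"
    by (intro list_measurable_ennreal list_measurable_prod_list assms)
  have "tuple_integral (Suc k) (\<lambda>xs. ennreal (\<Prod>x\<leftarrow>xs. g x)) = (\<integral>\<^sup>+v. tuple_integral k (\<lambda>xs. ennreal (g v) * ennreal (\<Prod>x\<leftarrow>xs. g x)) \<partial>lborel)"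
    unfolding tuple_integral_Suc[OF m] by (simp add: ennreal_mult nn prod_list_nonneg' mult.commute)
  also have "\<dots> = (\<integral>\<^sup>+v. g v * (\<integral>\<^sup>+x. g x \<partial>lborel) ^ k \<partial>lborel)"
    by (simp add: tuple_integral_cmult[OF m] Suc.IH)
  also have "\<dots> = (\<integral>\<^sup>+x. g x \<partial>lborel) * (\<integral>\<^sup>+x. g x \<partial>lborel) ^ k"
    by (rule nn_integral_multc) measurable
  finally show ?case by simp
qed simp

text \<open>Without the exponential bound either the Bochner integrals or the real series could take
  junk values.\<close>
lemma poisson_sum_eq_series:
  fixes f :: "'a::euclidean_space list \<Rightarrow> real"
  assumes f: "list_measurable f" "\<And>xs. 0 \<le> f xs"
    and bound: "\<And>k. tuple_integral k (\<lambda>xs. ennreal (f xs)) \<le> ennreal (K * c ^ k)" and "0 \<le> K" "0 \<le> c"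
  shows "poisson_sum (\<lambda>xs. ennreal (f xs))
       = ennreal (\<Sum>k. (1 / fact k) * (\<integral>x. f (map x [0..<k]) \<partial>kspace k))" (is ?eq)
    and "0 \<le> (\<Sum>k. (1 / fact k) * (\<integral>x. f (map x [0..<k]) \<partial>kspace k))" (is ?nn)
proof -
  let ?I = "\<lambda>k. \<integral>x. f (map x [0..<k]) \<partial>kspace k"
  have I: "ennreal (?I k) = tuple_integral k (\<lambda>xs. ennreal (f xs))" for k
  proof -
    have "?I k = enn2real (tuple_integral k (\<lambda>xs. ennreal (f xs)))"
      unfolding tuple_integral_def using f by (intro integral_eq_nn_integral) (auto simp: list_measurable_def)
    moreover have "tuple_integral k (\<lambda>xs. ennreal (f xs)) < top"
      using bound[of k] by (rule le_less_trans) simp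
    ultimately show ?thesis by simp
  qed
  have I0: "0 \<le> ?I k" for k using f by simp
  have Ib: "?I k \<le> K * c ^ k" for k
    using bound[of k] assms(4,5) unfolding I[symmetric] by (subst (asm) ennreal_le_iff) auto
  have "summable (\<lambda>k. K * (c ^ k / fact k))"
    using summable_exp[of c] by (intro summable_mult) (simp add: divide_inverse mult.commute)
  then have sm: "summable (\<lambda>k. (1 / fact k) * ?I k)"
    by (rule summable_comparison_test') (use I0 Ib in \<open>auto simp: divide_right_mono\<close>)
  then show ?eq
    unfolding poisson_sum_def I[symmetric] using I0
    by (subst suminf_ennreal2[symmetric]) (auto intro!: suminf_cong simp: ennreal_mult[symmetric])
  show ?nn using sm I0 by (intro suminf_nonneg) auto
qed

subsection \<open>Weights of configurations\<close>

text \<open>Each point is paired with the later ones only, which reproduces the products over i < j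
  in \<open>weight\<close> and lets concatenation split off the interaction between two
  blocks.\<close>

primrec list_weight :: "('a::euclidean_space \<Rightarrow> ereal) \<Rightarrow> ('a \<Rightarrow> real) \<Rightarrow> 'a list \<Rightarrow> real" where
  "list_weight \<phi> lam [] = 1"
| "list_weight \<phi> lam (a # xs) = lam a * (\<Prod>y\<leftarrow>xs. boltz \<phi> (a - y)) * list_weight \<phi> lam xs"

lemma list_weight_append:
  "list_weight \<phi> lam (xs @ ys) = list_weight \<phi> lam xs * list_weight \<phi> lam ys * (\<Prod>a\<leftarrow>xs. \<Prod>y\<leftarrow>ys. boltz \<phi> (a - y))"
  by (induction xs) auto

text \<open>Any factor attached to single points is a change of activity. With an indicator this
  restricts the domain; with \<open>boltz \<phi> (v - x)\<close> it inserts a test point at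
  v.\<close>

lemma list_weight_mult:
  "list_weight \<phi> (\<lambda>x. lam x * g x) xs = list_weight \<phi> lam xs * (\<Prod>x\<leftarrow>xs. g x)"
  by (induction xs) auto

lemma prod_list_upt: "(\<Prod>i\<leftarrow>[0..<k]. f i) = (\<Prod>i<k. f i)"
  by (induction k) (simp_all add: mult.commute)

text \<open>\<open>list_weight\<close> recurses at the front while k grows at the end, so the step
  goes through \<open>list_weight_append\<close> with a one-point second block.\<close>

lemma weight_eq_list_weight: "weight \<phi> lam k x = list_weight \<phi> lam (map x [0..<k])"
proof (induction k)
  case 0 show ?case by (simp add: weight_def)
next
  case (Suc k)
  have "(\<Prod>i<Suc k. \<Prod>j\<in>{i<..<Suc k}. boltz \<phi> (x i - x j)) =
     (\<Prod>i<k. (\<Prod>j\<in>{i<..<k}. boltz \<phi> (x i - x j)) * boltz \<phi> (x i - x k))"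
  proof -
    have "{i<..<Suc k} = insert k {i<..<k}" if "i < k" for i using that by auto
    moreover have "{k<..<Suc k} = {}" by auto
    ultimately show ?thesis by (auto intro!: prod.cong simp: mult.commute)
  qed
  then have "weight \<phi> lam (Suc k) x = weight \<phi> lam k x * lam (x k) * (\<Prod>i<k. boltz \<phi> (x i - x k))"
    by (simp add: weight_def prod.distrib)
  then show ?case
    by (simp add: Suc list_weight_append prod_list_upt[symmetric] comp_def)
qed

text \<open>The total mass is the base c of the bounds c^k behind the convergence of the series for
  \<open>gibbs_Z\<close> and \<open>janossy\<close>.\<close>

definition finite_activity :: "('a::euclidean_space \<Rightarrow> real) \<Rightarrow> bool" where
  "finite_activity lam \<longleftrightarrow> lam \<in> borel_measurable borel \<and> (\<forall>x. 0 \<le> lam x) \<and> (\<integral>\<^sup>+x. lam x \<partial>lborel) < \<infinity>"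

lemma activity_finite: "activity lam \<Longrightarrow> finite_activity lam" for lam :: "'a::euclidean_space \<Rightarrow> real"
proof -
  assume a: "activity lam"
  then obtain M where M: "\<And>x. \<bar>lam x\<bar> \<le> M" 
    unfolding activity_def bounded_iff by (metis rangeI real_norm_def)
  obtain R where R: "\<And>x. lam x \<noteq> 0 \<Longrightarrow> norm x \<le> R"
    using a by (auto simp: activity_def bounded_iff)
  have "(\<integral>\<^sup>+x. lam x \<partial>lborel) \<le> (\<integral>\<^sup>+x. ennreal M * indicator (cball (0::'a) R) x \<partial>lborel)"
  proof (rule nn_integral_mono)
    fix x show "ennreal (lam x) \<le> ennreal M * indicator (cball 0 R) x"
      using M[of x] R[of x] by (cases "lam x = 0") (auto intro!: ennreal_leI)
  qed
  also have "\<dots> < \<infinity>"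
    using emeasure_lborel_cball_finite[of "0::'a" R] by (subst nn_integral_cmult_indicator) (auto simp: ennreal_mult_less_top)
  finally show ?thesis using a by (simp add: finite_activity_def activity_def)
qed

lemma finite_activityI:
  assumes "finite_activity lam" "lam' \<in> borel_measurable borel" "\<And>x. 0 \<le> lam' x" "\<And>x. lam' x \<le> lam x"
  shows "finite_activity lam'"
proof -
  have "(\<integral>\<^sup>+x. lam' x \<partial>lborel) \<le> (\<integral>\<^sup>+x. lam x \<partial>lborel)"
    using assms(4) by (intro nn_integral_mono ennreal_leI)
  then show ?thesis using assms by (auto simp: finite_activity_def)
qed

lemma boltz_nonneg: "0 \<le> boltz \<phi> x"
  by (simp add: boltz_def)

lemma poisson_sum_add:
  assumes "list_measurable F" "list_measurable G"
  shows "poisson_sum (\<lambda>xs. F xs + G xs) = poisson_sum F + poisson_sum G"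
proof -
  have "tuple_integral k (\<lambda>xs. F xs + G xs) = tuple_integral k F + tuple_integral k G" for k
    unfolding tuple_integral_def using assms by (intro nn_integral_add) (auto simp: list_measurable_def)
  then show ?thesis unfolding poisson_sum_def by (simp add: distrib_left suminf_add)
qed

lemma poisson_sum_split_first_terms:
  fixes F :: "'a::euclidean_space list \<Rightarrow> ennreal"
  shows "poisson_sum F = F [] + tuple_integral 1 F + (\<Sum>k. ennreal (1 / fact (k + 2)) * tuple_integral (k + 2) F)"
  using suminf_offset[of "\<lambda>k. ennreal (1 / fact k) * tuple_integral k F" 2] unfolding poisson_sum_def
  by (simp add: numeral_2_eq_2 add.commute)

lemma tuple_integral_1: "list_measurable F \<Longrightarrow> tuple_integral 1 F = (\<integral>\<^sup>+v. F [v] \<partial>lborel)"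
  using tuple_integral_Suc[of F 0] by simp

lemma list_measurable_times_real:
  fixes F G :: "'a::euclidean_space list \<Rightarrow> real"
  shows "list_measurable F \<Longrightarrow> list_measurable G \<Longrightarrow> list_measurable (\<lambda>xs. F xs * G xs)"
  by (simp add: list_measurable_def borel_measurable_times)

subsection \<open>Volumes of slabs and boxes\<close>

lemma measure_translate: 
  assumes "A \<in> sets borel" 
  shows "(+) c ` A \<in> sets borel" "measure lborel ((+) c ` A) = measure lborel (A :: 'a::euclidean_space set)"
proof -
  have eq: "(+) c ` A = (\<lambda>x. x - c) -` A" by (auto simp: image_iff) (metis add.commute diff_add_cancel)
  have "(\<lambda>x. x - c) \<in> borel_measurable borel" by measurable
  from measurable_sets[OF this assms] show m: "(+) c ` A \<in> sets borel" by (simp add: eq)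
  have "measure lborel ((+) c ` A) = measure (distr lborel borel ((+) c)) ((+) c ` A)"
    by (simp add: lborel_distr_plus)
  also have "\<dots> = measure lborel ((+) c -` ((+) c ` A))"
    using m by (subst measure_distr) auto
  also have "(+) c -` ((+) c ` A) = A" by auto
  finally show "measure lborel ((+) c ` A) = measure lborel A" .
qed

lemma bounded_emeasure_lborel: 
  "bounded S \<Longrightarrow> emeasure lborel S < \<infinity>"
  using emeasure_bounded_finite[of S] by simp

text \<open>N disjoint translates of the slab fit into a slightly larger ball.\<close>
lemma measure_slab_le:
  fixes u :: "'a::euclidean_space"
  assumes u: "norm u = 1" and N: "N > 0"
  shows "measure lborel (ball 0 R \<inter> {y. t \<le> u \<bullet> y \<and> u \<bullet> y < t + 1 / real N}) \<le> measure lborel (ball (0::'a) (R + 1)) / N"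
proof -
  let ?S = "ball (0::'a) R \<inter> {y. t \<le> u \<bullet> y \<and> u \<bullet> y < t + 1 / real N}"
  have S: "?S \<in> sets borel" by measurable
  let ?T = "\<lambda>j::nat. (+) ((real j / N) *\<^sub>R u) ` ?S"
  have uu: "u \<bullet> u = 1" using u by (simp add: dot_square_norm)
  have h: "t + real j / N \<le> u \<bullet> y \<and> u \<bullet> y < t + real j / N + 1 / N" if "y \<in> ?T j" for j y
    using that uu by (auto simp: inner_add_right)
  have disj: "disjoint_family_on ?T {..<N}"
    unfolding disjoint_family_on_def
  proof (intro ballI impI)
    fix i j :: nat assume "i \<noteq> j"
    then have "real i + 1 \<le> real j \<or> real j + 1 \<le> real i" by linarith
    then have "real i / N + 1 / N \<le> real j / N \<or> real j / N + 1 / N \<le> real i / N"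
      using N by (metis add_divide_distrib divide_right_mono of_nat_0_le_iff)
    then show "?T i \<inter> ?T j = {}" using h[of _ i] h[of _ j] by fastforce
  qed
  have sub: "(\<Union>j<N. ?T j) \<subseteq> ball 0 (R + 1)"
  proof safe
    fix j y assume j: "j < N" and y: "y \<in> ball (0::'a) R"
    have "norm ((real j / N) *\<^sub>R u + y) \<le> real j / N + norm y"
      using norm_triangle_ineq[of "(real j / N) *\<^sub>R u" y] u by simp
    also have "real j / N \<le> 1" using j by simp
    finally show "(real j / N) *\<^sub>R u + y \<in> ball 0 (R + 1)" using y by simp
  qed
  have fin: "emeasure lborel (ball (0::'a) c) < \<infinity>" for c by (intro bounded_emeasure_lborel bounded_ball)
  have "N * measure lborel ?S = (\<Sum>j<N. measure lborel (?T j))"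
    using measure_translate(2)[OF S] by simp
  also have "\<dots> = measure lborel (\<Union>j<N. ?T j)"
  proof (rule measure_finite_Union[symmetric])
    show "?T ` {..<N} \<subseteq> sets lborel" using measure_translate(1)[OF S] by auto
    show "emeasure lborel (?T i) \<noteq> \<infinity>" if "i \<in> {..<N}" for i
    proof -
      have "emeasure lborel (?T i) \<le> emeasure lborel (ball (0::'a) (R + 1))"
        using sub that by (intro emeasure_mono) auto
      then show ?thesis using fin[of "R + 1"] by (auto simp: top_unique)
    qed
  qed (use disj in auto)
  also have "\<dots> \<le> measure lborel (ball (0::'a) (R + 1))"
    using sub fin[of "R + 1"] measure_translate(1)[OF S] by (intro measure_mono_fmeasurable) (auto simp: fmeasurable_def)
  finally show ?thesis using N by (simp add: field_simps)
qed

lemma measure_box_n: "measure lborel (box_n n :: 'a::euclidean_space set) = (2 * real n) ^ DIM('a)"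
proof -
  have "measure lborel (box_n n :: 'a set) = (\<Prod>b\<in>(Basis::'a set). 2 * real n)"
    unfolding box_n_def by (subst measure_lborel_cbox_eq) (auto intro!: prod.cong simp: algebra_simps)
  then show ?thesis by simp
qed

lemma ball_subset_box_n:
  assumes "x \<in> box_n m" "m + k \<le> n" shows "ball x (real k) \<subseteq> (box_n n :: 'a::euclidean_space set)"
proof
  fix y assume y: "y \<in> ball x (real k)"
  show "y \<in> box_n n"
    unfolding box_n_def mem_box
  proof
    fix b :: 'a assume b: "b \<in> Basis"
    have "\<bar>(y - x) \<bullet> b\<bar> < k" using Basis_le_norm[OF b, of "y - x"] y by (simp add: dist_norm norm_minus_commute)
    moreover have "- real m \<le> x \<bullet> b \<and> x \<bullet> b \<le> real m"
      using assms(1) b by (auto simp: box_n_def mem_box)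
    moreover have "real m + real k \<le> real n" using assms(2) by linarith
    ultimately show "(- (real n *\<^sub>R One)) \<bullet> b \<le> y \<bullet> b \<and> y \<bullet> b \<le> (real n *\<^sub>R One) \<bullet> b"
      using b by (auto simp: inner_diff_left abs_less_iff)
  qed
qed

lemma activity_indicator:
  assumes "A \<in> sets borel" "bounded A" "0 \<le> l"
  shows "activity (\<lambda>x. l * indicator A x)"
proof -
  have "bounded (range (\<lambda>x. l * indicator A x :: real))"
    by (rule boundedI[of _ l]) (use assms in \<open>auto simp: indicator_def\<close>)
  moreover have "bounded {x. l * indicator A x \<noteq> 0}"
    by (rule bounded_subset[OF assms(2)]) (auto simp: indicator_def)
  ultimately show ?thesis using assms by (auto simp: activity_def)
qed

text \<open>The first quantity will be the error for filling the gap up to a half space, the second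
  a bound for the activity mass of one slab; a and b are the ball volumes from
  \<open>measure_slab_le\<close>.\<close>

lemma fine_mesh:
  fixes a b :: real
  assumes "0 < e"
  obtains N where "N > 0" "exp (l * (a / real N)) - 1 \<le> e" "l * (b / real N) \<le> e"
proof -
  have "(\<lambda>N. exp (l * (a / real N)) - 1) \<longlonglongrightarrow> exp (l * 0) - 1"
    by (intro tendsto_intros lim_const_over_n)
  then have 1: "\<forall>\<^sub>F N in sequentially. exp (l * (a / real N)) - 1 < e"
    using assms by (intro order_tendstoD(2)) auto
  have "(\<lambda>N. l * (b / real N)) \<longlonglongrightarrow> l * 0"
    by (intro tendsto_intros lim_const_over_n)
  then have 2: "\<forall>\<^sub>F N in sequentially. l * (b / real N) < e"
    using assms by (intro order_tendstoD(2)) auto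
  obtain N where "N > 0 \<and> exp (l * (a / real N)) - 1 < e \<and> l * (b / real N) < e"
    using eventually_happens[OF eventually_conj[OF eventually_gt_at_top[of 0] eventually_conj[OF 1 2]]] by auto
  then show ?thesis by (intro that[of N]) auto
qed

subsection \<open>Partition functions\<close>

locale pair_potential =
  fixes \<phi> :: "'a::euclidean_space \<Rightarrow> ereal"
  assumes repulsive: "repulsive_finite_range \<phi>"
begin

section \<open>Bounds and symmetry of the weights for a repulsive potential\<close>

lemma boltz_le_1: "boltz \<phi> x \<le> 1"
  using repulsive unfolding boltz_def repulsive_finite_range_def by (auto simp: real_of_ereal_pos)

lemma boltz_minus_commute: "boltz \<phi> (x - y) = boltz \<phi> (y - x)"
  using repulsive unfolding boltz_def repulsive_finite_range_def by (metis minus_diff_eq)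

lemma boltz_measurable [measurable]: "boltz \<phi> \<in> borel_measurable borel"
proof -
  have [measurable]: "\<phi> \<in> borel_measurable borel" 
    using repulsive by (simp add: repulsive_finite_range_def)
  show ?thesis unfolding boltz_def[abs_def] by measurable
qed

lemma prod_boltz_bounds: "0 \<le> (\<Prod>y\<leftarrow>ys. boltz \<phi> (a - y))" "(\<Prod>y\<leftarrow>ys. boltz \<phi> (a - y)) \<le> 1"
  by (induction ys) (auto simp: boltz_nonneg boltz_le_1 mult_le_one)

lemma prod_prod_boltz_bounds:
  "0 \<le> (\<Prod>a\<leftarrow>xs. \<Prod>y\<leftarrow>ys. boltz \<phi> (a - y))" "(\<Prod>a\<leftarrow>xs. \<Prod>y\<leftarrow>ys. boltz \<phi> (a - y)) \<le> 1"
  by (induction xs) (auto simp: prod_boltz_bounds mult_le_one)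

lemma list_weight_nonneg: "(\<And>x. 0 \<le> lam x) \<Longrightarrow> 0 \<le> list_weight \<phi> lam xs"
  by (induction xs) (auto simp: prod_boltz_bounds)

lemma list_weight_le: "(\<And>x. 0 \<le> lam x) \<Longrightarrow> list_weight \<phi> lam xs \<le> (\<Prod>x\<leftarrow>xs. lam x)"
proof (induction xs)
  case (Cons a xs)
  have "lam a * ((\<Prod>y\<leftarrow>xs. boltz \<phi> (a - y)) * list_weight \<phi> lam xs) \<le> lam a * (1 * (\<Prod>x\<leftarrow>xs. lam x))"
    using Cons by (intro mult_left_mono mult_mono) (auto simp: prod_boltz_bounds list_weight_nonneg)
  then show ?case by (simp add: mult.assoc)
qed simp

text \<open>Repulsion: all factors between the two blocks and inside the first one are at most 1.
  The upper bounds on Janossy densities derive from this inequality.\<close>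

lemma list_weight_append_le:
  assumes "\<And>x. 0 \<le> lam x"
  shows "list_weight \<phi> lam (xs @ ys) \<le> (\<Prod>x\<leftarrow>xs. lam x) * list_weight \<phi> lam ys"
proof -
  have "list_weight \<phi> lam (xs @ ys) \<le> list_weight \<phi> lam xs * list_weight \<phi> lam ys * 1"
    unfolding list_weight_append using assms
    by (intro mult_left_mono) (auto simp: prod_prod_boltz_bounds list_weight_nonneg)
  also have "\<dots> \<le> (\<Prod>x\<leftarrow>xs. lam x) * list_weight \<phi> lam ys"
    using assms by (auto intro!: mult_right_mono list_weight_le list_weight_nonneg)
  finally show ?thesis .
qed

lemma prod_list_mset_cong: "mset xs = mset ys \<Longrightarrow> (\<Prod>x\<leftarrow>xs. g x) = (\<Prod>x\<leftarrow>ys. g x :: real)"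
  by (metis mset_map prod_mset_prod_list)

text \<open>Rests on \<phi> being even: the factors between a and \<open>xs\<close> change the order
  of their arguments.\<close>

lemma list_weight_insert: "list_weight \<phi> lam (xs @ a # ys) = list_weight \<phi> lam (a # xs @ ys)"
proof -
  have "(\<Prod>z\<leftarrow>xs. boltz \<phi> (z - a)) = (\<Prod>z\<leftarrow>xs. boltz \<phi> (a - z))"
    by (simp add: boltz_minus_commute)
  moreover have "(\<Prod>z\<leftarrow>xs. boltz \<phi> (z - a) * (\<Prod>y\<leftarrow>ys. boltz \<phi> (z - y))) = 
    (\<Prod>z\<leftarrow>xs. boltz \<phi> (z - a)) * (\<Prod>z\<leftarrow>xs. \<Prod>y\<leftarrow>ys. boltz \<phi> (z - y))"
    by (induction xs) auto
  ultimately show ?thesis by (simp add: list_weight_append)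
qed

lemma list_weight_perm: "mset xs = mset ys \<Longrightarrow> list_weight \<phi> lam xs = list_weight \<phi> lam ys"
proof (induction xs arbitrary: ys)
  case (Cons a xs)
  then have "a \<in> set ys" by (metis list.set_intros(1) mset_eq_setD)
  then obtain y1 y2 where ys: "ys = y1 @ a # y2" by (meson split_list)
  then have m: "mset xs = mset (y1 @ y2)" using Cons.prems by simp
  have "list_weight \<phi> lam ys = list_weight \<phi> lam (a # y1 @ y2)"
    unfolding ys by (rule list_weight_insert)
  then show ?case
    using Cons.IH[OF m] prod_list_mset_cong[OF m, of "\<lambda>y. boltz \<phi> (a - y)"] by simp
qed simp

lemma list_measurable_weight:
  assumes [measurable]: "lam \<in> borel_measurable borel"
  shows "list_measurable (list_weight \<phi> lam)"
  unfolding list_measurable_def weight_eq_list_weight[symmetric] weight_def by measurable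

text \<open>Possibly infinite; \<open>partition_sum_eq\<close> returns to \<open>gibbs_Z\<close>
  once the total mass is finite.\<close>

definition partition_sum :: "('a \<Rightarrow> real) \<Rightarrow> ennreal" where
  "partition_sum lam = poisson_sum (\<lambda>xs. ennreal (list_weight \<phi> lam xs))"

lemma partition_sum_eq:
  assumes "finite_activity lam" shows "partition_sum lam = ennreal (gibbs_Z \<phi> lam)"
proof -
  note a = assms[unfolded finite_activity_def]
  define c where "c = enn2real (\<integral>\<^sup>+x. lam x \<partial>lborel)"
  have c: "(\<integral>\<^sup>+x. lam x \<partial>lborel) = ennreal c" "0 \<le> c" using a by (auto simp: c_def)
  have "tuple_integral k (\<lambda>xs. ennreal (list_weight \<phi> lam xs)) \<le> ennreal (1 * c ^ k)" for k
  proof -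
    have "tuple_integral k (\<lambda>xs. ennreal (list_weight \<phi> lam xs)) \<le> tuple_integral k (\<lambda>xs. ennreal (\<Prod>x\<leftarrow>xs. lam x))"
      using a by (intro tuple_integral_mono ennreal_leI list_weight_le) auto
    also have "\<dots> = ennreal (1 * c ^ k)" using a c by (simp add: tuple_integral_prod_list ennreal_power)
    finally show ?thesis .
  qed
  then show ?thesis
    unfolding partition_sum_def gibbs_Z_def weight_eq_list_weight
    using a c by (intro poisson_sum_eq_series[where K = 1 and c = c] list_measurable_weight list_weight_nonneg) auto
qed

text \<open>The empty configuration alone contributes 1, so division by Z and ln Z are safe
  later.\<close>

lemma partition_sum_ge_1: "1 \<le> partition_sum lam"
proof -
  have "(\<Sum>k<1. ennreal (1 / fact k) * tuple_integral k (\<lambda>xs. ennreal (list_weight \<phi> lam xs))) \<le> partition_sum lam"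
    unfolding partition_sum_def poisson_sum_def by (intro sum_le_suminf) auto
  then show ?thesis by simp
qed

lemma gibbs_Z_ge_1: assumes "finite_activity lam" shows "1 \<le> gibbs_Z \<phi> lam"
proof (rule ccontr)
  assume "\<not> ?thesis"
  then have "ennreal (gibbs_Z \<phi> lam) < 1" by (simp add: ennreal_less_one_iff)
  with partition_sum_ge_1[of lam] partition_sum_eq[OF assms] show False by (metis leD)
qed

text \<open>A test point at v damps the activity by its Boltzmann factor, so the unnormalised
  expectation is again a partition function and the estimates for Z apply to it.\<close>

lemma gibbs_EZ_eq: "gibbs_EZ \<phi> lam v = gibbs_Z \<phi> (\<lambda>x. lam x * boltz \<phi> (v - x))"
  unfolding gibbs_EZ_def gibbs_Z_def weight_eq_list_weight list_weight_mult
  by (simp add: prod_list_upt[symmetric] comp_def)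

lemma list_measurable_weight_nn:
  "lam \<in> borel_measurable borel \<Longrightarrow> list_measurable (\<lambda>xs. ennreal (list_weight \<phi> lam xs))"
  by (intro list_measurable_ennreal list_measurable_weight)

lemma list_weight_perm_invariant: "perm_invariant (\<lambda>xs. ennreal (list_weight \<phi> lam xs))"
  unfolding perm_invariant_def by (intro allI impI arg_cong[where f = ennreal] list_weight_perm)

text \<open>The unnormalised Janossy density of the restriction to A.\<close>
definition janossy_sum :: "('a \<Rightarrow> real) \<Rightarrow> 'a set \<Rightarrow> 'a list \<Rightarrow> ennreal" where
  "janossy_sum lam A xs = poisson_sum (\<lambda>ys. indicator (lists (-A)) ys * ennreal (list_weight \<phi> lam (xs @ ys)))"

lemma indicator_mult_list_weight:
  "indicator (lists B) xs * ennreal (list_weight \<phi> lam xs) = ennreal (list_weight \<phi> (\<lambda>x. lam x * indicator B x) xs)"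
  unfolding list_weight_mult indicator_lists[symmetric] by (simp add: indicator_def)

lemma partition_sum_split:
  assumes "lam \<in> borel_measurable borel" "A \<in> sets borel"
  shows "partition_sum lam = poisson_sum (\<lambda>xs. indicator (lists A) xs * janossy_sum lam A xs)"
  unfolding partition_sum_def janossy_sum_def
  by (rule poisson_sum_split[OF list_measurable_weight_nn[OF assms(1)] list_weight_perm_invariant assms(2)])

lemma list_measurable_janossy_sum:
  assumes "lam \<in> borel_measurable borel" "A \<in> sets borel"
  shows "list_measurable (janossy_sum lam A)"
  unfolding janossy_sum_def using assms
  by (intro list_measurable_poisson_sum_append list_measurable_weight_nn list_measurable_indicator) auto

lemma janossy_sum_Nil: "janossy_sum lam A [] = partition_sum (\<lambda>x. lam x * indicator (-A) x)"
  unfolding janossy_sum_def partition_sum_def by (simp add: indicator_mult_list_weight)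

text \<open>Ignoring the interaction of \<open>xs\<close> with the outside leaves the sum for the
  empty configuration, that is, the partition function of the complement.\<close>

lemma janossy_sum_le:
  assumes "lam \<in> borel_measurable borel" "\<And>x. 0 \<le> lam x" "A \<in> sets borel"
  shows "janossy_sum lam A xs \<le> ennreal (\<Prod>x\<leftarrow>xs. lam x) * janossy_sum lam A []"
proof -
  have "-A \<in> sets borel" using assms(3) by auto
  then have m: "list_measurable (\<lambda>ys. indicator (lists (-A)) ys * ennreal (list_weight \<phi> lam ([] @ ys)))"
    using assms by (intro list_measurable_times list_measurable_indicator) (simp_all add: list_measurable_weight_nn)
  show ?thesis
    unfolding janossy_sum_def poisson_sum_cmult[OF m]
  proof (rule poisson_sum_mono)
    fix ys
    have "ennreal (list_weight \<phi> lam (xs @ ys)) \<le> ennreal (\<Prod>x\<leftarrow>xs. lam x) * ennreal (list_weight \<phi> lam ys)"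
      using list_weight_append_le[of lam xs ys, OF assms(2)] assms(2)
      by (simp add: ennreal_mult[symmetric] prod_list_nonneg' list_weight_nonneg ennreal_leI)
    then show "indicator (lists (-A)) ys * ennreal (list_weight \<phi> lam (xs @ ys)) \<le>
       ennreal (\<Prod>x\<leftarrow>xs. lam x) * (indicator (lists (-A)) ys * ennreal (list_weight \<phi> lam ([] @ ys)))"
      by (simp add: indicator_def)
  qed
qed

lemma janossy_sum_le_partition_sum:
  assumes "lam \<in> borel_measurable borel" "\<And>x. 0 \<le> lam x" "A \<in> sets borel"
  shows "janossy_sum lam A xs \<le> ennreal (\<Prod>x\<leftarrow>xs. lam x) * partition_sum lam"
proof -
  have "janossy_sum lam A [] \<le> partition_sum lam"
    unfolding janossy_sum_def partition_sum_def by (intro poisson_sum_mono) (simp add: indicator_def)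
  then show ?thesis
    using janossy_sum_le[OF assms, where xs = xs] by (meson mult_left_mono order_trans zero_le)
qed

text \<open>For v in A, the outside points form a gas whose activity is damped by v. When A is a
  thin slab this is the main term of the expansion.\<close>

lemma janossy_sum_singleton: "janossy_sum lam A [v] = ennreal (lam v) * partition_sum (\<lambda>x. lam x * indicator (-A) x * boltz \<phi> (v - x))"
  if "lam \<in> borel_measurable borel" "\<And>x. 0 \<le> lam x" "A \<in> sets borel"
proof -
  have "-A \<in> sets borel" using that by auto
  note [measurable] = that(1) this
  have "list_measurable (\<lambda>xs. ennreal (list_weight \<phi> (\<lambda>x. lam x * indicator (-A) x * boltz \<phi> (v - x)) xs))"
    by (rule list_measurable_weight_nn) measurable
  then have "ennreal (lam v) * partition_sum (\<lambda>x. lam x * indicator (-A) x * boltz \<phi> (v - x)) 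
     = poisson_sum (\<lambda>xs. ennreal (lam v) * ennreal (list_weight \<phi> (\<lambda>x. lam x * indicator (-A) x * boltz \<phi> (v - x)) xs))"
    unfolding partition_sum_def by (rule poisson_sum_cmult)
  also have "\<dots> = janossy_sum lam A [v]"
    unfolding janossy_sum_def list_weight_mult indicator_lists[symmetric]
    using that(2) by (intro arg_cong[where f = poisson_sum] ext)
      (auto simp: indicator_def ennreal_mult[symmetric] list_weight_nonneg prod_boltz_bounds mult_ac)
  finally show ?thesis ..
qed

text \<open>Each of the k points in S costs a factor s, the activity mass of S; their repulsion from
  each other and from the rest is dropped.\<close>

lemma tuple_integral_partition_sum_terms_le:
  assumes lam: "lam \<in> borel_measurable borel" "\<And>x. 0 \<le> lam x" and S: "S \<in> sets borel"
    and s: "(\<integral>\<^sup>+x\<in>S. lam x \<partial>lborel) = ennreal s" "0 \<le> s"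
  shows "tuple_integral k (\<lambda>xs. indicator (lists S) xs * janossy_sum lam S xs) \<le> ennreal (s ^ k) * partition_sum (\<lambda>x. lam x * indicator (-S) x)"
proof -
  let ?Z = "partition_sum (\<lambda>x. lam x * indicator (-S) x)"
  have m: "(\<lambda>x. lam x * indicator S x) \<in> borel_measurable borel" using lam S by auto
  have "tuple_integral k (\<lambda>xs. indicator (lists S) xs * janossy_sum lam S xs)
    \<le> tuple_integral k (\<lambda>xs. ?Z * ennreal (\<Prod>x\<leftarrow>xs. lam x * indicator S x))"
  proof (rule tuple_integral_mono)
    fix xs
    have "indicator (lists S) xs * janossy_sum lam S xs \<le> indicator (lists S) xs * (ennreal (\<Prod>x\<leftarrow>xs. lam x) * ?Z)"
      using janossy_sum_le[OF lam S, where xs = xs] by (intro mult_left_mono) (auto simp: janossy_sum_Nil)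
    also have "\<dots> = ?Z * ennreal (\<Prod>x\<leftarrow>xs. lam x * indicator S x)"
    proof -
      have "(\<Prod>x\<leftarrow>xs. lam x * indicator S x) = (\<Prod>x\<leftarrow>xs. lam x) * indicator (lists S) xs"
        unfolding indicator_lists by (induction xs) auto
      then show ?thesis by (simp add: indicator_def mult.commute)
    qed
    finally show "indicator (lists S) xs * janossy_sum lam S xs \<le> ?Z * ennreal (\<Prod>x\<leftarrow>xs. lam x * indicator S x)" .
  qed
  also have "\<dots> = ?Z * (\<integral>\<^sup>+x. lam x * indicator S x \<partial>lborel) ^ k"
    using m lam by (subst tuple_integral_cmult[OF list_measurable_ennreal[OF list_measurable_prod_list]]) (auto simp: tuple_integral_prod_list)
  also have "(\<integral>\<^sup>+x. ennreal (lam x * indicator S x) \<partial>lborel) = ennreal s"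
    unfolding s(1)[symmetric] by (intro nn_integral_cong) (auto simp: indicator_def)
  finally show ?thesis using s(2) by (simp add: ennreal_power mult.commute)
qed

text \<open>Adding a region S to the domain: the term with one point in S is kept explicitly, two or
  more points contribute only to second order.\<close>
lemma partition_sum_add_region:
  assumes lam: "lam \<in> borel_measurable borel" "\<And>x. 0 \<le> lam x" and S: "S \<in> sets borel"
    and s: "(\<integral>\<^sup>+x\<in>S. lam x \<partial>lborel) = ennreal s" "0 \<le> s"
  defines "L \<equiv> \<lambda>x. lam x * indicator (-S) x"
  defines "I \<equiv> \<integral>\<^sup>+v\<in>S. ennreal (lam v) * partition_sum (\<lambda>x. L x * boltz \<phi> (v - x)) \<partial>lborel"
  shows "partition_sum L + I \<le> partition_sum lam" "partition_sum lam \<le> partition_sum L + I + ennreal (exp s - 1 - s) * partition_sum L"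
    "partition_sum lam \<le> ennreal (exp s) * partition_sum L"
proof -
  let ?G = "\<lambda>xs. indicator (lists S) xs * janossy_sum lam S xs"
  let ?R = "\<Sum>k. ennreal (1 / fact (k + 2)) * tuple_integral (k + 2) ?G"
  have G: "list_measurable ?G"
    by (intro list_measurable_times list_measurable_indicator list_measurable_janossy_sum lam S)
  have k1: "tuple_integral 1 ?G = I"
    unfolding tuple_integral_1[OF G] I_def L_def
    by (intro nn_integral_cong) (auto simp: indicator_def janossy_sum_singleton[OF lam S])
  have eq: "partition_sum lam = partition_sum L + I + ?R"
    unfolding partition_sum_split[OF lam(1) S] poisson_sum_split_first_terms k1 by (simp add: janossy_sum_Nil L_def)
  then show "partition_sum L + I \<le> partition_sum lam" by simp
  have b: "tuple_integral k ?G \<le> ennreal (s ^ k) * partition_sum L" for k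
    unfolding L_def by (rule tuple_integral_partition_sum_terms_le[OF lam S s])
  have sm: "summable (\<lambda>k. s ^ k / fact k)"
    using summable_exp[of s] by (simp add: divide_inverse mult.commute)
  have "?R \<le> (\<Sum>k. ennreal (s ^ (k + 2) / fact (k + 2)) * partition_sum L)"
  proof (intro suminf_le)
    fix k
    have "ennreal (1 / fact (k + 2)) * tuple_integral (k + 2) ?G \<le> ennreal (1 / fact (k + 2)) * (ennreal (s ^ (k + 2)) * partition_sum L)"
      by (intro mult_left_mono b) auto
    also have "\<dots> = ennreal (s ^ (k + 2) / fact (k + 2)) * partition_sum L"
      using s(2) by (simp add: mult.assoc[symmetric] ennreal_mult[symmetric])
    finally show "ennreal (1 / fact (k + 2)) * tuple_integral (k + 2) ?G \<le> ennreal (s ^ (k + 2) / fact (k + 2)) * partition_sum L" .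
  qed auto
  also have "\<dots> = (\<Sum>k. ennreal (s ^ (k + 2) / fact (k + 2))) * partition_sum L"
    by simp
  also have "(\<Sum>k. ennreal (s ^ (k + 2) / fact (k + 2))) = ennreal (\<Sum>k. s ^ (k + 2) / fact (k + 2))"
    using s(2) summable_ignore_initial_segment[OF sm, of 2] by (intro suminf_ennreal2) auto
  \<comment> \<open>The tail of the exponential series from two points on, of order s^2.\<close>
  also have "(\<Sum>k. s ^ (k + 2) / fact (k + 2)) = exp s - 1 - s"
    using suminf_minus_initial_segment[OF sm, of 2]
    by (simp add: exp_def divide_inverse mult.commute numeral_2_eq_2)
  finally have R: "?R \<le> ennreal (exp s - 1 - s) * partition_sum L" .
  then show "partition_sum lam \<le> partition_sum L + I + ennreal (exp s - 1 - s) * partition_sum L"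
    unfolding eq by (intro add_left_mono)
  \<comment> \<open>The cruder multiplicative bound: the one-point term is at most s times the
    outside sum, and the coefficients 1, s and exp s - 1 - s add up to exp s.\<close>
  have "I \<le> ennreal s * partition_sum L" using b[of 1] k1 by simp
  then have "partition_sum lam \<le> partition_sum L + ennreal s * partition_sum L + ennreal (exp s - 1 - s) * partition_sum L"
    unfolding eq using R by (intro add_mono) auto
  also have "\<dots> = (ennreal 1 + ennreal s + ennreal (exp s - 1 - s)) * partition_sum L"
    by (simp add: distrib_right)
  also have "ennreal 1 + ennreal s + ennreal (exp s - 1 - s) = ennreal (exp s)"
    proof -
    have "0 \<le> exp s - 1 - s" using exp_ge_add_one_self[of s] by linarith
    then show ?thesis
      using s(2) ennreal_plus[of 1 s] ennreal_plus[of "1 + s" "exp s - 1 - s"] by (simp del: ennreal_plus)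
  qed
  finally show "partition_sum lam \<le> ennreal (exp s) * partition_sum L" .
qed

lemma partition_sum_mono:
  assumes "\<And>x. 0 \<le> lam x" "\<And>x. lam x \<le> lam' x"
  shows "partition_sum lam \<le> partition_sum lam'"
proof -
  have "list_weight \<phi> lam xs \<le> list_weight \<phi> lam' xs" for xs
  proof (induction xs)
    case (Cons a xs)
    then show ?case
      using assms list_weight_nonneg[of lam xs, OF assms(1)] order_trans[OF assms]
      by (auto intro!: mult_mono simp: prod_boltz_bounds)
  qed simp
  then show ?thesis unfolding partition_sum_def by (intro poisson_sum_mono ennreal_leI)
qed

lemma partition_sum_translate: 
  assumes "lam \<in> borel_measurable borel"
  shows "partition_sum (\<lambda>x. lam (x + c)) = partition_sum lam"
proof -
  have "list_weight \<phi> (\<lambda>x. lam (x + c)) xs = list_weight \<phi> lam (map (\<lambda>x. x + c) xs)" for xs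
    by (induction xs) (auto simp: comp_def)
  then show ?thesis
    unfolding partition_sum_def using poisson_sum_translate[OF list_measurable_weight_nn[OF assms]] by simp
qed

subsection \<open>Janossy densities and total variation\<close>

definition janossy_list :: "('a \<Rightarrow> real) \<Rightarrow> 'a set \<Rightarrow> 'a list \<Rightarrow> real" where
  "janossy_list lam A xs = enn2real (janossy_sum lam A xs) / gibbs_Z \<phi> lam"

text \<open>At fixed \<open>xs\<close> this is a Poisson sum over the outside points. Its real
  series converges because the weight is at most K, the product of the activities at
  \<open>xs\<close>, times the weight of the outside points alone.\<close>

lemma janossy_eq:
  assumes lam: "finite_activity lam" and A: "A \<in> sets borel"
  shows "janossy \<phi> lam A k x = janossy_list lam A (map x [0..<k])"
proof -
  note a = lam[unfolded finite_activity_def]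
  have A': "-A \<in> sets borel" using A by auto
  define c where "c = enn2real (\<integral>\<^sup>+x. lam x \<partial>lborel)"
  have c: "(\<integral>\<^sup>+x. lam x \<partial>lborel) = ennreal c" "0 \<le> c" using a by (auto simp: c_def)
  define xs where "xs = map x [0..<k]"
  define K where "K = (\<Prod>x\<leftarrow>xs. lam x)"
  have K: "0 \<le> K" using a by (simp add: K_def prod_list_nonneg')
  let ?f = "\<lambda>ys. (\<Prod>y\<leftarrow>ys. indicator (-A) y :: real) * list_weight \<phi> lam (xs @ ys)"
  have i01: "0 \<le> (\<Prod>y\<leftarrow>ys. indicator (-A) y :: real)" "(\<Prod>y\<leftarrow>ys. indicator (-A) y :: real) \<le> 1" for ys
    by (simp_all add: indicator_lists[symmetric])
  have f0: "0 \<le> ?f ys" for ys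
    using a i01 by (intro mult_nonneg_nonneg list_weight_nonneg) auto
  have lm: "list_measurable ?f"
    unfolding xs_def using a A'
    by (intro list_measurable_times_real list_measurable_prod_list list_measurable_append_left list_measurable_weight) auto
  have bd: "tuple_integral m (\<lambda>ys. ennreal (?f ys)) \<le> ennreal (K * c ^ m)" for m
  proof -
    have fle: "?f ys \<le> K * (\<Prod>y\<leftarrow>ys. lam y)" for ys
    proof -
      have "?f ys \<le> 1 * list_weight \<phi> lam (xs @ ys)"
        using a i01 by (intro mult_right_mono list_weight_nonneg) auto
      also have "\<dots> \<le> K * list_weight \<phi> lam ys"
        using a list_weight_append_le[of lam xs ys] by (simp add: K_def)
      also have "\<dots> \<le> K * (\<Prod>y\<leftarrow>ys. lam y)"
        using a K by (intro mult_left_mono list_weight_le) auto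
      finally show ?thesis .
    qed
    have "tuple_integral m (\<lambda>ys. ennreal (?f ys)) \<le> tuple_integral m (\<lambda>ys. ennreal K * ennreal (\<Prod>y\<leftarrow>ys. lam y))"
      using fle K a by (intro tuple_integral_mono) (simp add: ennreal_mult[symmetric] prod_list_nonneg' ennreal_leI)
    also have "\<dots> = ennreal (K * c ^ m)"
      using a c K by (subst tuple_integral_cmult[OF list_measurable_ennreal[OF list_measurable_prod_list]])
        (auto simp: tuple_integral_prod_list ennreal_power ennreal_mult)
    finally show ?thesis .
  qed
  have "janossy_sum lam A xs = poisson_sum (\<lambda>ys. ennreal (?f ys))"
    unfolding janossy_sum_def indicator_lists[symmetric] by (intro arg_cong[where f = poisson_sum] ext) (simp add: indicator_def)
  also have "\<dots> = ennreal (\<Sum>m. (1 / fact m) * (\<integral>y. ?f (map y [0..<m]) \<partial>kspace m))"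
    by (rule poisson_sum_eq_series(1)[OF lm f0 bd K c(2)])
  finally have "enn2real (janossy_sum lam A xs) = (\<Sum>m. (1 / fact m) * (\<integral>y. ?f (map y [0..<m]) \<partial>kspace m))"
    using poisson_sum_eq_series(2)[OF lm f0 bd K c(2)] by (simp only: enn2real_ennreal)
  then show ?thesis
    unfolding janossy_def janossy_list_def weight_eq_list_weight map_cat_config xs_def
    by (simp add: prod_list_upt[symmetric] comp_def mult.commute)
qed

lemma janossy_sum_finite: "finite_activity lam \<Longrightarrow> A \<in> sets borel \<Longrightarrow> janossy_sum lam A xs < \<infinity>"
  using janossy_sum_le_partition_sum[of lam A xs] partition_sum_eq[of lam]
  by (auto simp: finite_activity_def ennreal_mult_less_top intro: le_less_trans)

lemma janossy_list_nonneg: "finite_activity lam \<Longrightarrow> 0 \<le> janossy_list lam A xs"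
  using gibbs_Z_ge_1[of lam] by (simp add: janossy_list_def)

lemma ennreal_janossy_list:
  assumes "finite_activity lam" "A \<in> sets borel"
  shows "ennreal (janossy_list lam A xs) = ennreal (1 / gibbs_Z \<phi> lam) * janossy_sum lam A xs"
  unfolding janossy_list_def using janossy_sum_finite[OF assms, of xs] gibbs_Z_ge_1[OF assms(1)]
  by (cases "janossy_sum lam A xs") (auto simp: ennreal_mult[symmetric])

text \<open>Repulsion bounds the numerator by the product of activities times Z, and Z cancels. This
  pointwise bound makes the series in \<open>tv_restr\<close> converge.\<close>

lemma janossy_list_le:
  assumes "finite_activity lam" "A \<in> sets borel"
  shows "janossy_list lam A xs \<le> (\<Prod>x\<leftarrow>xs. lam x)"
proof -
  have P: "0 \<le> (\<Prod>x\<leftarrow>xs. lam x)" using assms(1) by (simp add: finite_activity_def prod_list_nonneg')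
  have "ennreal (janossy_list lam A xs) \<le> ennreal (1 / gibbs_Z \<phi> lam) * (ennreal (\<Prod>x\<leftarrow>xs. lam x) * partition_sum lam)"
    unfolding ennreal_janossy_list[OF assms] using assms by (intro mult_left_mono janossy_sum_le_partition_sum) (auto simp: finite_activity_def)
  also have "\<dots> = ennreal (\<Prod>x\<leftarrow>xs. lam x)"
    using gibbs_Z_ge_1[OF assms(1)] P by (simp add: partition_sum_eq[OF assms(1)] ennreal_mult[symmetric])
  finally show ?thesis using P by simp
qed

lemma list_measurable_janossy_list:
  assumes "finite_activity lam" "A \<in> sets borel"
  shows "list_measurable (janossy_list lam A)"
proof -
  have "list_measurable (janossy_sum lam A)"
    using assms by (intro list_measurable_janossy_sum) (auto simp: finite_activity_def)
  then have "(\<lambda>x. janossy_sum lam A (map x [0..<k])) \<in> borel_measurable (kspace k)" for k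
    by (simp add: list_measurable_def)
  then have "(\<lambda>x. enn2real (janossy_sum lam A (map x [0..<k]))) \<in> borel_measurable (kspace k)" for k
    by (rule borel_measurable_enn2real)
  then show ?thesis unfolding list_measurable_def janossy_list_def
    by (intro allI borel_measurable_divide borel_measurable_const)
qed

text \<open>Kept apart from \<open>rho\<close>, whose factor \<open>lam v\<close> would vanish: the
  slab argument evaluates the mean at points outside the domain, in the slab being added.\<close>

definition boltz_mean :: "('a \<Rightarrow> real) \<Rightarrow> 'a \<Rightarrow> real" where
  "boltz_mean lam v = gibbs_EZ \<phi> lam v / gibbs_Z \<phi> lam"

lemma finite_activity_boltz:
  assumes "finite_activity lam" shows "finite_activity (\<lambda>x. lam x * boltz \<phi> (v - x))"
proof (rule finite_activityI[OF assms])
  have [measurable]: "lam \<in> borel_measurable borel" using assms by (simp add: finite_activity_def)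
  show "(\<lambda>x. lam x * boltz \<phi> (v - x)) \<in> borel_measurable borel" by measurable
qed (use assms boltz_le_1 in \<open>auto simp: finite_activity_def boltz_nonneg intro: mult_left_le\<close>)

lemma boltz_mean_partition_sum:
  assumes "finite_activity lam"
  shows "ennreal (boltz_mean lam v) = ennreal (1 / gibbs_Z \<phi> lam) * partition_sum (\<lambda>x. lam x * boltz \<phi> (v - x))"
  unfolding boltz_mean_def gibbs_EZ_eq
  using gibbs_Z_ge_1[OF assms] gibbs_Z_ge_1[OF finite_activity_boltz[OF assms, of v]]
  by (simp add: partition_sum_eq[OF finite_activity_boltz[OF assms]] ennreal_mult[symmetric])

lemma partition_sum_boltz:
  assumes "finite_activity lam"
  shows "partition_sum (\<lambda>x. lam x * boltz \<phi> (v - x)) = ennreal (boltz_mean lam v) * partition_sum lam"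
  using gibbs_Z_ge_1[OF assms] gibbs_Z_ge_1[OF finite_activity_boltz[OF assms, of v]]
  by (simp add: partition_sum_eq[OF finite_activity_boltz[OF assms]] partition_sum_eq[OF assms] boltz_mean_def gibbs_EZ_eq ennreal_mult[symmetric])

lemma boltz_mean_bounds: assumes "finite_activity lam" shows "0 \<le> boltz_mean lam v" "boltz_mean lam v \<le> 1"
proof -
  show "0 \<le> boltz_mean lam v"
    using gibbs_Z_ge_1[OF assms] gibbs_Z_ge_1[OF finite_activity_boltz[OF assms, of v]]
    by (simp add: boltz_mean_def gibbs_EZ_eq)
  have "partition_sum (\<lambda>x. lam x * boltz \<phi> (v - x)) \<le> partition_sum lam"
    using assms boltz_le_1 by (intro partition_sum_mono) (auto simp: finite_activity_def boltz_nonneg intro: mult_left_le)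
  then have "gibbs_Z \<phi> (\<lambda>x. lam x * boltz \<phi> (v - x)) \<le> gibbs_Z \<phi> lam"
    using gibbs_Z_ge_1[OF assms]
    by (simp add: partition_sum_eq[OF finite_activity_boltz[OF assms]] partition_sum_eq[OF assms])
  then show "boltz_mean lam v \<le> 1"
    using gibbs_Z_ge_1[OF assms] by (simp add: boltz_mean_def gibbs_EZ_eq)
qed

text \<open>A contains the range of the potential around v, so points outside A contribute the
  factor 1 and the mean depends on the Janossy densities in A alone.\<close>

lemma boltz_mean_split:
  assumes lam: "finite_activity lam" and A: "A \<in> sets borel" and out: "\<And>x. x \<notin> A \<Longrightarrow> boltz \<phi> (v - x) = 1"
  shows "ennreal (boltz_mean lam v) = poisson_sum (\<lambda>xs. indicator (lists A) xs * ennreal (\<Prod>x\<leftarrow>xs. boltz \<phi> (v - x)) * ennreal (janossy_list lam A xs))"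
proof -
  note a = lam[unfolded finite_activity_def]
  let ?lb = "\<lambda>x. lam x * boltz \<phi> (v - x)"
  have [measurable]: "lam \<in> borel_measurable borel" using a by simp
  have mb: "?lb \<in> borel_measurable borel" by measurable
  have lmB: "list_measurable (\<lambda>xs. \<Prod>x\<leftarrow>xs. boltz \<phi> (v - x))"
    by (intro list_measurable_prod_list) measurable
  have J: "janossy_sum ?lb A xs = ennreal (\<Prod>x\<leftarrow>xs. boltz \<phi> (v - x)) * janossy_sum lam A xs" for xs
  proof -
    have *: "(\<Prod>y\<leftarrow>ys. boltz \<phi> (v - y)) = 1" if "ys \<in> lists (-A)" for ys
      using that by (induction ys) (auto simp: out)
    obtain x k where xs: "xs = map x [0..<k]" by (metis map_nth)
    have lm: "list_measurable (\<lambda>ys. indicator (lists (-A)) ys * ennreal (list_weight \<phi> lam (xs @ ys)))"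
      unfolding xs using A a
      by (intro list_measurable_times list_measurable_indicator list_measurable_ennreal list_measurable_append_left list_measurable_weight) auto
    show ?thesis
      unfolding janossy_sum_def poisson_sum_cmult[OF lm] list_weight_mult
      using a by (intro arg_cong[where f = poisson_sum] ext)
        (auto simp: indicator_def * ennreal_mult[symmetric] list_weight_nonneg prod_boltz_bounds mult_ac)
  qed
  have "partition_sum ?lb = poisson_sum (\<lambda>xs. indicator (lists A) xs * (ennreal (\<Prod>x\<leftarrow>xs. boltz \<phi> (v - x)) * janossy_sum lam A xs))"
    unfolding partition_sum_split[OF mb A] J ..
  then have "ennreal (boltz_mean lam v) = ennreal (1 / gibbs_Z \<phi> lam) * poisson_sum (\<lambda>xs. indicator (lists A) xs * (ennreal (\<Prod>x\<leftarrow>xs. boltz \<phi> (v - x)) * janossy_sum lam A xs))"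
    by (simp add: boltz_mean_partition_sum[OF lam])
  also have "\<dots> = poisson_sum (\<lambda>xs. ennreal (1 / gibbs_Z \<phi> lam) * (indicator (lists A) xs * (ennreal (\<Prod>x\<leftarrow>xs. boltz \<phi> (v - x)) * janossy_sum lam A xs)))"
    using a A by (intro poisson_sum_cmult list_measurable_times list_measurable_indicator list_measurable_ennreal lmB list_measurable_janossy_sum) auto
  also have "\<dots> = poisson_sum (\<lambda>xs. indicator (lists A) xs * ennreal (\<Prod>x\<leftarrow>xs. boltz \<phi> (v - x)) * ennreal (janossy_list lam A xs))"
    by (simp add: ennreal_janossy_list[OF lam A] mult_ac)
  finally show ?thesis .
qed

text \<open>The two claims work together: \<open>ennreal\<close> sends negative reals to 0, so the
  identity alone would not determine the real number.\<close>

lemma tv_restr_eq: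
  assumes lam: "finite_activity lam" "finite_activity lam'" and A: "A \<in> sets borel"
  shows "ennreal (2 * tv_restr \<phi> lam lam' A) = poisson_sum (\<lambda>xs. indicator (lists A) xs * ennreal \<bar>janossy_list lam A xs - janossy_list lam' A xs\<bar>)"
    "0 \<le> tv_restr \<phi> lam lam' A"
proof -
  note a = lam[unfolded finite_activity_def]
  define c where "c = enn2real (\<integral>\<^sup>+x. lam x + lam' x \<partial>lborel)"
  have m[measurable]: "lam \<in> borel_measurable borel" "lam' \<in> borel_measurable borel" using a by auto
  have "(\<integral>\<^sup>+x. lam x + lam' x \<partial>lborel) = (\<integral>\<^sup>+x. ennreal (lam x) + ennreal (lam' x) \<partial>lborel)"
    using a by (intro nn_integral_cong) auto
  also have "\<dots> < \<infinity>" using a by (subst nn_integral_add) auto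
  finally have c: "(\<integral>\<^sup>+x. lam x + lam' x \<partial>lborel) = ennreal c" "0 \<le> c" by (auto simp: c_def)
  let ?D = "\<lambda>xs. \<bar>janossy_list lam A xs - janossy_list lam' A xs\<bar>"
  let ?f = "\<lambda>xs. (\<Prod>x\<leftarrow>xs. indicator A x) * ?D xs"
  have ms: "(\<lambda>x. lam x + lam' x) \<in> borel_measurable borel" by measurable
  have lmD: "list_measurable ?D"
    using list_measurable_janossy_list[OF lam(1) A] list_measurable_janossy_list[OF lam(2) A] unfolding list_measurable_def
    by (auto intro!: borel_measurable_abs borel_measurable_diff)
  have lm: "list_measurable ?f"
    using A by (intro list_measurable_times_real list_measurable_prod_list lmD) auto
  have f0: "0 \<le> ?f xs" for xs by (simp add: indicator_lists[symmetric])
  \<comment> \<open>Each density is at most the product of its own activities; the sum of both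
    activities gives one common majorant.\<close>
  have fle: "?f xs \<le> 2 * (\<Prod>x\<leftarrow>xs. lam x + lam' x)" for xs
  proof -
    have p: "0 \<le> (\<Prod>x\<leftarrow>xs. lam x) \<and> (\<Prod>x\<leftarrow>xs. lam x) \<le> (\<Prod>x\<leftarrow>xs. lam x + lam' x)"
      "0 \<le> (\<Prod>x\<leftarrow>xs. lam' x) \<and> (\<Prod>x\<leftarrow>xs. lam' x) \<le> (\<Prod>x\<leftarrow>xs. lam x + lam' x)"
      by (induction xs) (use a in \<open>auto intro!: mult_mono\<close>)
    have "(\<Prod>x\<leftarrow>xs. indicator A x :: real) \<le> 1" by (simp add: indicator_lists[symmetric])
    from mult_right_mono[OF this abs_ge_zero] have "?f xs \<le> ?D xs" by simp
    also have "\<dots> \<le> 2 * (\<Prod>x\<leftarrow>xs. lam x + lam' x)"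
      using janossy_list_le[OF lam(1) A, of xs] janossy_list_le[OF lam(2) A, of xs] janossy_list_nonneg[OF lam(1), of A xs] janossy_list_nonneg[OF lam(2), of A xs] p
      by linarith
    finally show ?thesis .
  qed
  have bd: "tuple_integral m (\<lambda>xs. ennreal (?f xs)) \<le> ennreal (2 * c ^ m)" for m
  proof -
    have "tuple_integral m (\<lambda>xs. ennreal (?f xs)) \<le> tuple_integral m (\<lambda>xs. ennreal 2 * ennreal (\<Prod>x\<leftarrow>xs. lam x + lam' x))"
      using a by (intro tuple_integral_mono) (subst ennreal_mult[symmetric], auto intro!: ennreal_leI fle prod_list_nonneg')
    also have "\<dots> = ennreal (2 * c ^ m)"
      using a c ms by (subst tuple_integral_cmult[OF list_measurable_ennreal[OF list_measurable_prod_list]])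
        (auto simp: tuple_integral_prod_list ennreal_power ennreal_mult simp del: ennreal_plus)
    finally show ?thesis .
  qed
  have eq: "2 * tv_restr \<phi> lam lam' A = (\<Sum>k. (1 / fact k) * (\<integral>x. ?f (map x [0..<k]) \<partial>kspace k))"
    unfolding tv_restr_def janossy_eq[OF lam(1) A] janossy_eq[OF lam(2) A]
    by (simp add: prod_list_upt[symmetric] comp_def)
  have e: "ennreal (?f xs) = indicator (lists A) xs * ennreal (?D xs)" for xs
    unfolding indicator_lists[symmetric] by (simp add: indicator_def)
  have "poisson_sum (\<lambda>xs. ennreal (?f xs)) = ennreal (2 * tv_restr \<phi> lam lam' A)"
    unfolding eq by (rule poisson_sum_eq_series(1)[OF lm f0 bd _ c(2)]) simp
  then show "ennreal (2 * tv_restr \<phi> lam lam' A) = poisson_sum (\<lambda>xs. indicator (lists A) xs * ennreal (?D xs))"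
    by (simp only: e)
  have "0 \<le> 2 * tv_restr \<phi> lam lam' A"
    unfolding eq by (rule poisson_sum_eq_series(2)[OF lm f0 bd _ c(2)]) simp
  then show "0 \<le> tv_restr \<phi> lam lam' A" by simp
qed

text \<open>exp(-H_v) takes values in [0, 1], so the means differ by at most the L1 distance of the
  Janossy densities, which is twice the total variation. The one-sided form avoids subtraction in
  \<open>ennreal\<close>.\<close>

lemma boltz_mean_diff_le_tv:
  assumes lam: "finite_activity lam" "finite_activity lam'" and A: "A \<in> sets borel"
    and out: "\<And>x. x \<notin> A \<Longrightarrow> boltz \<phi> (v - x) = 1"
  shows "boltz_mean lam v \<le> boltz_mean lam' v + 2 * tv_restr \<phi> lam lam' A"
proof -
  let ?B = "\<lambda>xs. \<Prod>x\<leftarrow>xs. boltz \<phi> (v - x)"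
  have lmB: "list_measurable ?B"
    by (intro list_measurable_prod_list) measurable
  have lmD: "list_measurable (\<lambda>xs. \<bar>janossy_list lam A xs - janossy_list lam' A xs\<bar>)"
    using list_measurable_janossy_list[OF lam(1) A] list_measurable_janossy_list[OF lam(2) A] unfolding list_measurable_def
    by (auto intro!: borel_measurable_abs borel_measurable_diff)
  have "ennreal (boltz_mean lam v) = poisson_sum (\<lambda>xs. indicator (lists A) xs * ennreal (?B xs) * ennreal (janossy_list lam A xs))"
    by (rule boltz_mean_split[OF lam(1) A out])
  also have "\<dots> \<le> poisson_sum (\<lambda>xs. indicator (lists A) xs * ennreal (?B xs) * ennreal (janossy_list lam' A xs)
       + indicator (lists A) xs * ennreal \<bar>janossy_list lam A xs - janossy_list lam' A xs\<bar>)"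
  proof (rule poisson_sum_mono)
    fix xs
    have B: "0 \<le> ?B xs" "?B xs \<le> 1" by (fact prod_boltz_bounds)+
    have "?B xs * (janossy_list lam A xs - janossy_list lam' A xs) \<le> 1 * \<bar>janossy_list lam A xs - janossy_list lam' A xs\<bar>"
      using B mult_left_mono[OF abs_ge_self[of "janossy_list lam A xs - janossy_list lam' A xs"] B(1)]
        mult_right_mono[OF B(2) abs_ge_zero[of "janossy_list lam A xs - janossy_list lam' A xs"]] by linarith
    then have "?B xs * janossy_list lam A xs \<le> ?B xs * janossy_list lam' A xs + \<bar>janossy_list lam A xs - janossy_list lam' A xs\<bar>"
      by (simp add: algebra_simps)
    then have "ennreal (?B xs) * ennreal (janossy_list lam A xs) \<le> ennreal (?B xs) * ennreal (janossy_list lam' A xs) + ennreal \<bar>janossy_list lam A xs - janossy_list lam' A xs\<bar>"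
      using B janossy_list_nonneg[OF lam(1)] janossy_list_nonneg[OF lam(2)]
      by (simp add: ennreal_mult[symmetric] ennreal_plus[symmetric] ennreal_leI del: ennreal_plus)
    then show "indicator (lists A) xs * ennreal (?B xs) * ennreal (janossy_list lam A xs)
       \<le> indicator (lists A) xs * ennreal (?B xs) * ennreal (janossy_list lam' A xs)
       + indicator (lists A) xs * ennreal \<bar>janossy_list lam A xs - janossy_list lam' A xs\<bar>"
      by (simp add: indicator_def)
  qed
  also have "\<dots> = ennreal (boltz_mean lam' v) + ennreal (2 * tv_restr \<phi> lam lam' A)"
    unfolding boltz_mean_split[OF lam(2) A, of v, OF out, simplified] tv_restr_eq(1)[OF lam A]
    using list_measurable_janossy_list[OF lam(2) A] A
    by (intro poisson_sum_add list_measurable_times list_measurable_indicator list_measurable_ennreal lmB lmD) auto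
  also have "\<dots> = ennreal (boltz_mean lam' v + 2 * tv_restr \<phi> lam lam' A)"
    using boltz_mean_bounds[OF lam(2)] tv_restr_eq(2)[OF lam A] by simp
  finally show ?thesis
    using boltz_mean_bounds[OF lam(2), of v] tv_restr_eq(2)[OF lam A] by (subst (asm) ennreal_le_iff) auto
qed

subsection \<open>Removing a region from the domain\<close>

lemma boltz_mean_translate:
  assumes "finite_activity lam"
  shows "boltz_mean (\<lambda>y. lam (y + x)) 0 = boltz_mean lam x"
proof -
  note a = assms[unfolded finite_activity_def]
  have [measurable]: "lam \<in> borel_measurable borel" using a by simp
  have "(\<integral>\<^sup>+y. lam (y + x) \<partial>lborel) = (\<integral>\<^sup>+y. lam y \<partial>distr lborel borel ((+) x))"
    by (subst nn_integral_distr) (auto simp: add.commute)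
  then have lx: "finite_activity (\<lambda>y. lam (y + x))"
    using a by (simp add: finite_activity_def lborel_distr_plus)
  have "partition_sum (\<lambda>y. lam (y + x)) = partition_sum lam" by (rule partition_sum_translate) measurable
  moreover have "partition_sum (\<lambda>y. lam (y + x) * boltz \<phi> (0 - y)) = partition_sum (\<lambda>y. lam y * boltz \<phi> (x - y))"
    using partition_sum_translate[of "\<lambda>y. lam y * boltz \<phi> (x - y)" x] by (simp add: diff_diff_eq2)
  ultimately show ?thesis
    using gibbs_Z_ge_1[OF assms] gibbs_Z_ge_1[OF lx] gibbs_Z_ge_1[OF finite_activity_boltz[OF assms, of x]]
      gibbs_Z_ge_1[OF finite_activity_boltz[OF lx, of 0]]
    by (simp add: partition_sum_eq assms lx finite_activity_boltz[OF assms] finite_activity_boltz[OF lx, of 0, simplified] boltz_mean_def gibbs_EZ_eq)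
qed

text \<open>s only bounds the activity mass of S from above, because for the gap below a shifted
  half space just a volume estimate is available.\<close>

lemma gibbs_Z_remove_region:
  assumes lam: "finite_activity lam" and S: "S \<in> sets borel"
    and s: "(\<integral>\<^sup>+x\<in>S. lam x \<partial>lborel) \<le> ennreal s" "0 \<le> s"
  shows "finite_activity (\<lambda>x. lam x * indicator (-S) x)"
    "gibbs_Z \<phi> (\<lambda>x. lam x * indicator (-S) x) \<le> gibbs_Z \<phi> lam"
    "gibbs_Z \<phi> lam \<le> exp s * gibbs_Z \<phi> (\<lambda>x. lam x * indicator (-S) x)"
proof -
  note a = lam[unfolded finite_activity_def]
  let ?L = "\<lambda>x. lam x * indicator (-S) x"
  have S': "-S \<in> sets borel" using S by auto
  show L: "finite_activity ?L"
  proof (rule finite_activityI[OF lam])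
    show "?L \<in> borel_measurable borel" using a S' by (intro borel_measurable_times borel_measurable_indicator) auto
  qed (use a in \<open>auto simp: indicator_def\<close>)
  note Z = gibbs_Z_ge_1[OF L] gibbs_Z_ge_1[OF lam]
  have "partition_sum ?L \<le> partition_sum lam" using a by (intro partition_sum_mono) (auto simp: indicator_def)
  then show "gibbs_Z \<phi> ?L \<le> gibbs_Z \<phi> lam" using Z by (simp add: partition_sum_eq L lam)
  define s' where "s' = enn2real (\<integral>\<^sup>+x\<in>S. lam x \<partial>lborel)"
  have s': "(\<integral>\<^sup>+x\<in>S. lam x \<partial>lborel) = ennreal s'" "0 \<le> s'"
    using s le_less_trans[OF s(1), of top] by (auto simp: s'_def)
  then have "s' \<le> s" using s by simp
  have "partition_sum lam \<le> ennreal (exp s') * partition_sum ?L"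
    using a by (intro partition_sum_add_region(3)[OF _ _ S s']) auto
  then have "gibbs_Z \<phi> lam \<le> exp s' * gibbs_Z \<phi> ?L"
    using Z by (simp add: partition_sum_eq L lam ennreal_mult[symmetric])
  also have "\<dots> \<le> exp s * gibbs_Z \<phi> ?L" using Z \<open>s' \<le> s\<close> by (intro mult_right_mono) auto
  finally show "gibbs_Z \<phi> lam \<le> exp s * gibbs_Z \<phi> ?L" .
qed

text \<open>The mean is a ratio of two partition functions, each changed by a factor between 1 and
  exp s. Since the mean is at most 1, the relative error exp s - 1 is also an absolute one.\<close>

lemma boltz_mean_remove_region:
  assumes lam: "finite_activity lam" and S: "S \<in> sets borel"
    and s: "(\<integral>\<^sup>+x\<in>S. lam x \<partial>lborel) \<le> ennreal s" "0 \<le> s"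
  shows "\<bar>boltz_mean lam v - boltz_mean (\<lambda>x. lam x * indicator (-S) x) v\<bar> \<le> exp s - 1"
proof -
  let ?L = "\<lambda>x. lam x * indicator (-S) x" and ?B = "\<lambda>x. lam x * boltz \<phi> (v - x)"
  note a = lam[unfolded finite_activity_def]
  have sB: "(\<integral>\<^sup>+x\<in>S. ?B x \<partial>lborel) \<le> ennreal s"
    using a boltz_le_1
    by (intro order_trans[OF nn_integral_mono s(1)] mult_right_mono ennreal_leI) (auto simp: boltz_nonneg intro: mult_left_le)
  \<comment> \<open>Removing S commutes with damping by the test point, so the same estimate covers
    numerator and denominator.\<close>
  have eq: "(\<lambda>x. ?B x * indicator (-S) x) = (\<lambda>x. ?L x * boltz \<phi> (v - x))" by (auto simp: fun_eq_iff)
  note Z = gibbs_Z_remove_region[OF lam S s]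
  note W = gibbs_Z_remove_region[OF finite_activity_boltz[OF lam] S sB s(2), unfolded eq]
  define z z0 w w0 where "z = gibbs_Z \<phi> lam" "z0 = gibbs_Z \<phi> ?L" "w = gibbs_Z \<phi> ?B" "w0 = gibbs_Z \<phi> (\<lambda>x. ?L x * boltz \<phi> (v - x))"
  have pos: "1 \<le> z" "1 \<le> z0" "1 \<le> w" "1 \<le> w0"
    unfolding z_z0_w_w0_def using gibbs_Z_ge_1 lam Z(1) W(1) finite_activity_boltz[OF lam] by auto
  have ineq: "z0 \<le> z" "z \<le> exp s * z0" "w0 \<le> w" "w \<le> exp s * w0"
    unfolding z_z0_w_w0_def using Z W by auto
  have b: "boltz_mean lam v = w / z" "boltz_mean ?L v = w0 / z0"
    unfolding z_z0_w_w0_def boltz_mean_def gibbs_EZ_eq by auto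
  have le1: "w0 / z0 \<le> 1" using boltz_mean_bounds(2)[OF Z(1), of v] b by simp
  have "w / z \<le> exp s * w0 / z0"
    using ineq pos by (intro frac_le) auto
  also have "\<dots> = w0 / z0 + (exp s - 1) * (w0 / z0)" by (simp add: algebra_simps diff_divide_distrib)
  also have "\<dots> \<le> w0 / z0 + (exp s - 1) * 1"
    using le1 s(2) by (intro add_left_mono mult_left_mono) auto
  finally have up: "w / z - w0 / z0 \<le> exp s - 1" by simp
  have z1: "w / z \<le> 1" using boltz_mean_bounds(2)[OF lam, of v] b by simp
  have "w0 / z0 \<le> exp s * w / z"
  proof -
    have "w0 * z \<le> w * (exp s * z0)" using ineq pos by (intro mult_mono) auto
    then show ?thesis using pos by (simp add: field_simps)
  qed
  also have "\<dots> = w / z + (exp s - 1) * (w / z)" by (simp add: algebra_simps diff_divide_distrib)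
  also have "\<dots> \<le> w / z + (exp s - 1) * 1"
    using z1 s(2) by (intro add_left_mono mult_left_mono) auto
  finally have "w0 / z0 - w / z \<le> exp s - 1" by simp
  with up show ?thesis unfolding b by linarith
qed

text \<open>The three error terms are the deviation from E at the good points G, the trivial bound
  between 0 and 1 on the mean off G, and second-order effects, both of several points in S and of
  expanding ln.\<close>

lemma ln_gibbs_Z_step:
  assumes l: "0 < l" and A: "A \<in> sets borel" "bounded A" and S: "S \<in> sets borel" "bounded S" "A \<inter> S = {}"
    and G: "G \<in> sets borel" and E: "0 \<le> E" "E \<le> 1" and eta: "0 \<le> \<eta>"
    and small: "l * measure lborel S \<le> 1"
    and close: "\<And>x. x \<in> S \<inter> G \<Longrightarrow> \<bar>boltz_mean (\<lambda>x. l * indicator A x) x - E\<bar> \<le> \<eta>"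
  shows "\<bar>ln (gibbs_Z \<phi> (\<lambda>x. l * indicator (A \<union> S) x)) - ln (gibbs_Z \<phi> (\<lambda>x. l * indicator A x)) - l * E * measure lborel S\<bar>
    \<le> l * \<eta> * measure lborel S + l * measure lborel (S - G) + (l * measure lborel S)\<^sup>2"
proof -
  let ?lA = "\<lambda>x. l * indicator A x :: real" and ?lam = "\<lambda>x. l * indicator (A \<union> S) x :: real"
  define m mG where "m = measure lborel S" and "mG = measure lborel (S - G)"
  define s where "s = l * m"
  have fS: "emeasure lborel S = ennreal m"
    unfolding m_def using bounded_emeasure_lborel[OF S(2)] by (simp add: emeasure_eq_ennreal_measure)
  have fSG: "emeasure lborel (S - G) = ennreal mG"
    unfolding mG_def using bounded_emeasure_lborel[OF bounded_diff[OF S(2), of G]]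
    by (simp add: emeasure_eq_ennreal_measure)
  have m0: "0 \<le> m" "0 \<le> mG" by (auto simp: m_def mG_def)
  have mI: "measure lborel (S \<inter> G) = m - mG"
  proof -
    have "S = (S \<inter> G) \<union> (S - G)" by auto
    moreover have "measure lborel ((S \<inter> G) \<union> (S - G)) = measure lborel (S \<inter> G) + measure lborel (S - G)"
      using fS S(1) G emeasure_mono[of "S \<inter> G" S lborel] emeasure_mono[of "S - G" S lborel]
      by (intro measure_Union) (auto simp: top_unique)
    ultimately show ?thesis by (simp add: m_def mG_def)
  qed
  have fI: "emeasure lborel (S \<inter> G) = ennreal (m - mG)"
    unfolding mI[symmetric] using bounded_emeasure_lborel[OF bounded_subset[OF S(2), of "S \<inter> G"]]
    by (simp add: emeasure_eq_ennreal_measure)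
  have mle: "mG \<le> m" using mI measure_nonneg[of lborel "S \<inter> G"] by linarith
  have s: "0 \<le> s" "s \<le> 1" using small l m0 by (auto simp: s_def m_def)
  have fA: "finite_activity ?lA" using activity_indicator[OF A, of l] l by (simp add: activity_finite)
  have f: "finite_activity ?lam" using activity_indicator[of "A \<union> S" l] A S l by (simp add: activity_finite)
  note Z = gibbs_Z_ge_1[OF fA] gibbs_Z_ge_1[OF f]
  have L: "?lam x * indicator (-S) x = ?lA x" for x using S(3) by (auto simp: indicator_def)
  have ints: "(\<integral>\<^sup>+x\<in>S. ?lam x \<partial>lborel) = ennreal s"
  proof -
    have "(\<integral>\<^sup>+x\<in>S. ?lam x \<partial>lborel) = (\<integral>\<^sup>+x. ennreal l * indicator S x \<partial>lborel)"
      by (intro nn_integral_cong) (auto simp: indicator_def)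
    also have "\<dots> = ennreal s" using S l m0 by (simp add: nn_integral_cmult_indicator fS s_def ennreal_mult)
    finally show ?thesis .
  qed
  define I where "I = (\<integral>\<^sup>+v\<in>S. ennreal (?lam v) * partition_sum (\<lambda>x. ?lA x * boltz \<phi> (v - x)) \<partial>lborel)"
  have lm: "?lam \<in> borel_measurable borel" "\<And>x. 0 \<le> ?lam x" using f by (auto simp: finite_activity_def)
  note R = partition_sum_add_region[OF lm S(1) ints s(1), unfolded L, folded I_def]
  let ?z = "gibbs_Z \<phi> ?lA" and ?z' = "gibbs_Z \<phi> ?lam"
  have Ieq: "I = (\<integral>\<^sup>+v. ennreal (l * ?z * boltz_mean ?lA v) * indicator S v \<partial>lborel)"
    unfolding I_def partition_sum_boltz[OF fA] partition_sum_eq[OF fA]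
  proof (rule nn_integral_cong)
    fix v
    show "ennreal (?lam v) * (ennreal (boltz_mean ?lA v) * ennreal ?z) * indicator S v = ennreal (l * ?z * boltz_mean ?lA v) * indicator S v"
      using Z l boltz_mean_bounds(1)[OF fA, of v] by (cases "v \<in> S") (simp_all add: ennreal_mult mult_ac)
  qed
  have up: "?z' \<le> ?z + l * ?z * ((E + \<eta>) * m + mG) + (exp s - 1 - s) * ?z"
  proof -
    have "I \<le> (\<integral>\<^sup>+v. ennreal (l * ?z * (E + \<eta>)) * indicator S v + ennreal (l * ?z) * indicator (S - G) v \<partial>lborel)"
      unfolding Ieq
    proof (rule nn_integral_mono)
      fix v
      consider "v \<in> S \<inter> G" | "v \<in> S - G" | "v \<notin> S" by auto
      then show "ennreal (l * ?z * boltz_mean ?lA v) * indicator S v \<le> 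
         ennreal (l * ?z * (E + \<eta>)) * indicator S v + ennreal (l * ?z) * indicator (S - G) v"
      proof cases
        case 1
        have "l * ?z * boltz_mean ?lA v \<le> l * ?z * (E + \<eta>)"
          using close[OF 1] Z l by (intro mult_left_mono) (auto simp: abs_le_iff)
        then show ?thesis using 1 by (simp add: ennreal_leI)
      next
        case 2
        have "l * ?z * boltz_mean ?lA v \<le> l * ?z * 1"
          using boltz_mean_bounds(2)[OF fA] Z l by (intro mult_left_mono) auto
        then show ?thesis using 2 by (auto simp: ennreal_leI intro: add_increasing)
      qed auto
    qed
    also have "\<dots> = ennreal (l * ?z * (E + \<eta>)) * ennreal m + ennreal (l * ?z) * ennreal mG"
      using S G by (subst nn_integral_add) (auto simp: nn_integral_cmult_indicator fS fSG)
    also have "\<dots> = ennreal (l * ?z * ((E + \<eta>) * m + mG))"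
      using Z l E eta m0 by (simp add: ennreal_mult[symmetric] ennreal_plus[symmetric] distrib_left mult.assoc del: ennreal_plus)
    finally have I: "I \<le> ennreal (l * ?z * ((E + \<eta>) * m + mG))" .
    have e: "0 \<le> exp s - 1 - s" using exp_ge_add_one_self[of s] by linarith
    have "ennreal ?z' \<le> ennreal ?z + ennreal (l * ?z * ((E + \<eta>) * m + mG)) + ennreal ((exp s - 1 - s) * ?z)"
      using R(2) I Z e unfolding partition_sum_eq[OF fA] partition_sum_eq[OF f]
      by (auto simp: ennreal_mult intro: order_trans add_mono)
    also have "\<dots> = ennreal (?z + l * ?z * ((E + \<eta>) * m + mG) + (exp s - 1 - s) * ?z)"
      using Z l E eta m0 e by (simp add: ennreal_plus[symmetric] del: ennreal_plus)
    finally show ?thesis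
      using Z l E eta m0 e by (subst (asm) ennreal_le_iff) auto
  qed
  \<comment> \<open>Truncating E - \<eta> at 0 keeps a lower bound for the mean at good points and
    makes q below nonnegative.\<close>
  define w where "w = max 0 (E - \<eta>)"
  have w: "0 \<le> w" "w \<le> 1" "E - \<eta> \<le> w" using E eta by (auto simp: w_def)
  have low: "?z + l * ?z * w * (m - mG) \<le> ?z'"
  proof -
    have "ennreal (l * ?z * w) * ennreal (m - mG) = (\<integral>\<^sup>+v. ennreal (l * ?z * w) * indicator (S \<inter> G) v \<partial>lborel)"
      using S G by (simp add: nn_integral_cmult_indicator fI)
    also have "\<dots> \<le> I"
      unfolding Ieq
    proof (rule nn_integral_mono)
      fix v
      show "ennreal (l * ?z * w) * indicator (S \<inter> G) v \<le> ennreal (l * ?z * boltz_mean ?lA v) * indicator S v"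
      proof (cases "v \<in> S \<inter> G")
        case True
        then have "l * ?z * w \<le> l * ?z * boltz_mean ?lA v"
          using close[OF True] Z l boltz_mean_bounds(1)[OF fA, of v] by (intro mult_left_mono) (auto simp: w_def abs_le_iff)
        then show ?thesis using True by (simp add: ennreal_leI)
      qed (auto simp: indicator_def)
    qed
    finally have "ennreal ?z + ennreal (l * ?z * w) * ennreal (m - mG) \<le> ennreal ?z'"
      using R(1) unfolding partition_sum_eq[OF fA] partition_sum_eq[OF f] by (meson add_left_mono order_trans)
    then show ?thesis
      using Z l w mle by (simp add: ennreal_mult[symmetric] ennreal_plus[symmetric] del: ennreal_plus)
  qed
  have lnq: "ln ?z' - ln ?z = ln (?z' / ?z)" using Z by (simp add: ln_div)
  have "ln (?z' / ?z) \<le> l * ((E + \<eta>) * m + mG) + (exp s - 1 - s)"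
  proof -
    have "?z' / ?z \<le> 1 + (l * ((E + \<eta>) * m + mG) + (exp s - 1 - s))"
    proof (subst pos_divide_le_eq)
      show "?z' \<le> (1 + (l * ((E + \<eta>) * m + mG) + (exp s - 1 - s))) * ?z"
        using up by (simp add: algebra_simps)
    qed (use Z in simp)
    moreover have "ln (?z' / ?z) \<le> ?z' / ?z - 1" using Z by (intro ln_le_minus_one) auto
    ultimately show ?thesis by linarith
  qed
  moreover have "exp s - 1 - s \<le> s\<^sup>2" using exp_bound[OF s] by simp
  ultimately have u: "ln ?z' - ln ?z - l * E * m \<le> l * \<eta> * m + l * mG + s\<^sup>2"
    unfolding lnq by (simp add: algebra_simps)
  \<comment> \<open>The guaranteed relative increase of Z; q between 0 and s, hence at most 1,
    permits the second-order lower bound of ln (1 + q).\<close>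
  define q where "q = l * w * (m - mG)"
  have q: "0 \<le> q" "q \<le> s"
  proof -
    show "0 \<le> q" using l w mle by (simp add: q_def)
    have "w * (m - mG) \<le> 1 * m" using w mle m0 by (intro mult_mono) auto
    then show "q \<le> s" using l by (simp add: q_def s_def mult.assoc)
  qed
  have "q - q\<^sup>2 \<le> ln (1 + q)" using q s by (intro ln_one_plus_pos_lower_bound) auto
  also have "\<dots> \<le> ln (?z' / ?z)"
  proof -
    have "1 + q \<le> ?z' / ?z"
    proof (subst pos_le_divide_eq)
      show "(1 + q) * ?z \<le> ?z'" using low by (simp add: q_def algebra_simps)
    qed (use Z in simp)
    then show ?thesis using q by (subst ln_le_cancel_iff) auto
  qed
  finally have "q - q\<^sup>2 \<le> ln ?z' - ln ?z" unfolding lnq .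
  moreover have "q\<^sup>2 \<le> s\<^sup>2" using q by (intro power_mono) auto
  moreover have "l * E * m - l * \<eta> * m - l * mG \<le> q"
  proof -
    have "(E - \<eta>) * m \<le> w * m" using w m0 by (intro mult_right_mono) auto
    moreover have "w * mG \<le> 1 * mG" using w m0 by (intro mult_right_mono) auto
    ultimately have "(E - \<eta>) * m - mG \<le> w * (m - mG)" by (simp add: algebra_simps)
    from mult_left_mono[OF this, of l] l show ?thesis by (simp add: q_def algebra_simps)
  qed
  ultimately have "- (l * \<eta> * m + l * mG + s\<^sup>2) \<le> ln ?z' - ln ?z - l * E * m" by linarith
  with u show ?thesis unfolding m_def mG_def s_def by (simp add: abs_le_iff)
qed

subsection \<open>Strong spatial mixing and the half-space limit\<close>

lemma rho_eq_boltz_mean: "rho \<phi> lam v = lam v * boltz_mean lam v"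
  by (simp add: rho_def boltz_mean_def)

text \<open>Taking r at least 1 keeps the ball in \<open>boltz_mean_local\<close> nonempty, so that
  \<open>setdist\<close> from it is a genuine distance.\<close>

lemma range_ge_1: "\<exists>r\<ge>1. \<forall>x. norm x > r \<longrightarrow> boltz \<phi> x = 1"
proof -
  obtain r where r: "\<And>x. norm x > r \<Longrightarrow> \<phi> x = 0"
    using repulsive unfolding repulsive_finite_range_def by auto
  then have "boltz \<phi> x = 1" if "norm x > max r 1" for x
    using that by (simp add: boltz_def)
  then show ?thesis by (intro exI[of _ "max r 1"]) auto
qed

text \<open>The test function at 0 sees only the ball of radius r, and activities that agree up to
  radius R differ at distance at least R - r from it.\<close>

lemma boltz_mean_local:
  assumes "strong_spatial_mixing \<phi> l"
  obtains C \<beta> r where "0 < C" "0 < \<beta>"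
    "\<And>lam lam' R. \<lbrakk>activity lam; activity lam'; \<And>x. lam x \<le> l; \<And>x. lam' x \<le> l;
       \<And>x. norm x < R \<Longrightarrow> lam x = lam' x\<rbrakk> \<Longrightarrow> \<bar>boltz_mean lam 0 - boltz_mean lam' 0\<bar> \<le> C * exp (- \<beta> * (R - r))"
proof -
  obtain \<alpha> \<beta> where ab: "\<alpha> > 0" "\<beta> > 0" and all: "\<forall>\<Lambda> lam lam'. \<Lambda> \<in> sets lborel \<and> bounded \<Lambda> \<and> activity lam \<and> activity lam'
        \<and> (\<forall>x. lam x \<le> l) \<and> (\<forall>x. lam' x \<le> l) \<longrightarrow>
        tv_restr \<phi> lam lam' \<Lambda> \<le> \<alpha> * measure lborel \<Lambda> * exp (- \<beta> * setdist \<Lambda> {x. lam x \<noteq> lam' x})"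
    using assms unfolding strong_spatial_mixing_def by (elim exE conjE) (rule that)
  have ssm: "tv_restr \<phi> lam lam' \<Lambda> \<le> \<alpha> * measure lborel \<Lambda> * exp (- \<beta> * setdist \<Lambda> {x. lam x \<noteq> lam' x})"
    if "\<Lambda> \<in> sets lborel" "bounded \<Lambda>" "activity lam" "activity lam'" "\<And>x. lam x \<le> l" "\<And>x. lam' x \<le> l" for \<Lambda> lam lam'
    by (rule all[rule_format]) (intro conjI allI that)
  obtain r where r: "r \<ge> 1" "\<And>x. norm x > r \<Longrightarrow> boltz \<phi> x = 1"
    using range_ge_1 by blast
  define B where "B = cball (0::'a) r"
  define C where "C = 2 * \<alpha> * (measure lborel B + 1)"
  have C: "0 < C" using ab by (simp add: C_def add_nonneg_pos)
  have one: "boltz_mean lam 0 - boltz_mean lam' 0 \<le> C * exp (- \<beta> * (R - r))"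
    if lam: "activity lam" "activity lam'" "\<And>x. lam x \<le> l" "\<And>x. lam' x \<le> l"
      and agree: "\<And>x. norm x < R \<Longrightarrow> lam x = lam' x" for lam lam' R
  \<comment> \<open>Equal activities are treated apart: \<open>setdist\<close> to the empty set is
    0, so mixing would give no decay.\<close>
  proof (cases "lam = lam'")
    case True
    then show ?thesis using C by simp
  next
    case False
    let ?D = "{x. lam x \<noteq> lam' x}"
    have sd: "R - r \<le> setdist B ?D"
    proof (rule le_setdistI)
      show "B \<noteq> {}" using r by (auto simp: B_def)
      show "?D \<noteq> {}" using False by auto
      fix x y assume "x \<in> B" "y \<in> ?D"
      then have "norm x \<le> r" "R \<le> norm y" using agree by (auto simp: B_def not_less[symmetric])
      then show "R - r \<le> dist x y" using norm_triangle_ineq2[of y x] by (simp add: dist_norm norm_minus_commute)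
    qed
    have out: "boltz \<phi> (0 - x) = 1" if "x \<notin> B" for x
      using that r(2)[of "- x"] by (simp add: B_def)
    have "boltz_mean lam 0 - boltz_mean lam' 0 \<le> 2 * tv_restr \<phi> lam lam' B"
      using boltz_mean_diff_le_tv[OF activity_finite[OF lam(1)] activity_finite[OF lam(2)], of B 0, OF _ out]
      by (simp add: B_def)
    also have "\<dots> \<le> 2 * (\<alpha> * measure lborel B * exp (- \<beta> * setdist B ?D))"
      using lam by (intro mult_left_mono ssm) (auto simp: B_def)
    also have "\<dots> \<le> C * exp (- \<beta> * (R - r))"
    proof -
      have "exp (- \<beta> * setdist B ?D) \<le> exp (- \<beta> * (R - r))" using sd ab by simp
      moreover have "2 * \<alpha> * measure lborel B \<le> C" using ab by (simp add: C_def)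
      ultimately have "(2 * \<alpha> * measure lborel B) * exp (- \<beta> * setdist B ?D) \<le> C * exp (- \<beta> * (R - r))"
        using C by (intro mult_mono) auto
      then show ?thesis by (simp add: mult.assoc)
    qed
    finally show ?thesis .
  qed
  show ?thesis
  proof (rule that[of C \<beta> r])
    fix lam lam' :: "'a \<Rightarrow> real" and R
    assume lam: "activity lam" "activity lam'" "\<And>x. lam x \<le> l" "\<And>x. lam' x \<le> l"
      and agree: "\<And>x. norm x < R \<Longrightarrow> lam x = lam' x"
    show "\<bar>boltz_mean lam 0 - boltz_mean lam' 0\<bar> \<le> C * exp (- \<beta> * (R - r))"
      using one[OF lam(1,2) lam(3,4), of R] one[OF lam(2,1) lam(4,3), of R] agree by (simp add: abs_le_iff)
  qed (use C ab in auto)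
qed

text \<open>Mixing makes the means of the truncated half spaces Cauchy. The same comparison, passed
  to the limit, covers every activity that looks like the half space up to radius R.\<close>

lemma half_space_limit:
  assumes "strong_spatial_mixing \<phi> l" "0 < l"
  obtains E C \<beta> r where "0 \<le> E" "E \<le> 1" "0 < C" "0 < \<beta>"
    "(\<lambda>n::nat. boltz_mean (\<lambda>x. l * indicator {x. u \<bullet> x \<ge> 0} x * indicator (ball 0 (real n)) x) 0) \<longlonglongrightarrow> E"
    "\<And>lam R. \<lbrakk>activity lam; \<And>x. lam x \<le> l; \<And>x. norm x < R \<Longrightarrow> lam x = l * indicator {x. u \<bullet> x \<ge> 0} x\<rbrakk>
      \<Longrightarrow> \<bar>boltz_mean lam 0 - E\<bar> \<le> C * exp (- \<beta> * (R - r))"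
proof -
  obtain C \<beta> r where C: "0 < C" "0 < \<beta>" and loc:
    "\<And>lam lam' R. \<lbrakk>activity lam; activity lam'; \<And>x. lam x \<le> l; \<And>x. lam' x \<le> l;
       \<And>x. norm x < R \<Longrightarrow> lam x = lam' x\<rbrakk> \<Longrightarrow> \<bar>boltz_mean lam 0 - boltz_mean lam' 0\<bar> \<le> C * exp (- \<beta> * (R - r))"
    by (rule boltz_mean_local[OF assms(1)]) blast
  let ?h = "\<lambda>(n::nat) x. l * indicator {x. u \<bullet> x \<ge> 0} x * indicator (ball 0 (real n)) x :: real"
  have eq: "?h n = (\<lambda>x. l * indicator ({x. u \<bullet> x \<ge> 0} \<inter> ball 0 (real n)) x)" for n
    by (auto simp: fun_eq_iff indicator_def)
  have act: "activity (?h n)" for n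
    unfolding eq using assms(2) by (intro activity_indicator bounded_Int) auto
  have le: "?h n x \<le> l" for n x using assms(2) by (auto simp: indicator_def)
  have C0: "(\<lambda>n::nat. C * exp (- \<beta> * (real n - r))) \<longlonglongrightarrow> 0"
  proof -
    have eq: "exp (- \<beta> * (real n - r)) = exp (\<beta> * r) * exp (- \<beta>) ^ n" for n
      by (simp add: exp_of_nat_mult[symmetric] exp_add[symmetric] algebra_simps)
    have "(\<lambda>n::nat. exp (- \<beta>) ^ n) \<longlonglongrightarrow> 0"
      using C by (intro LIMSEQ_power_zero) simp
    then have "(\<lambda>n::nat. exp (- \<beta> * (real n - r))) \<longlonglongrightarrow> 0"
      unfolding eq by (rule tendsto_mult_right_zero)
    then show ?thesis using tendsto_mult_right_zero by blast
  qed
  have "Cauchy (\<lambda>n. boltz_mean (?h n) 0)"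
  proof (rule CauchyI')
    fix e :: real assume "e > 0"
    then obtain M where M: "\<And>n. n \<ge> M \<Longrightarrow> C * exp (- \<beta> * (real n - r)) < e"
      using order_tendstoD(2)[OF C0, of e] by (auto simp: eventually_sequentially)
    show "\<exists>M. \<forall>m\<ge>M. \<forall>n>m. dist (boltz_mean (?h m) 0) (boltz_mean (?h n) 0) < e"
    proof (intro exI[of _ M] allI impI)
      fix m n assume "M \<le> m" "m < n"
      have "\<bar>boltz_mean (?h m) 0 - boltz_mean (?h n) 0\<bar> \<le> C * exp (- \<beta> * (real m - r))"
        using \<open>m < n\<close> by (intro loc act le) (auto simp: indicator_def)
      then show "dist (boltz_mean (?h m) 0) (boltz_mean (?h n) 0) < e" using M[OF \<open>M \<le> m\<close>] by (simp add: dist_real_def)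
    qed
  qed
  then obtain E where E: "(\<lambda>n. boltz_mean (?h n) 0) \<longlonglongrightarrow> E"
    using Cauchy_convergent convergent_def by blast
  show ?thesis
  proof (rule that[OF _ _ C E])
    show "0 \<le> E" by (rule LIMSEQ_le_const[OF E]) (use boltz_mean_bounds(1)[OF activity_finite[OF act]] in blast)
    show "E \<le> 1" by (rule LIMSEQ_le_const2[OF E]) (use boltz_mean_bounds(2)[OF activity_finite[OF act]] in blast)
    fix lam :: "'a \<Rightarrow> real" and R
    assume lam: "activity lam" "\<And>x. lam x \<le> l" "\<And>x. norm x < R \<Longrightarrow> lam x = l * indicator {x. u \<bullet> x \<ge> 0} x"
    have "(\<lambda>n. \<bar>boltz_mean lam 0 - boltz_mean (?h n) 0\<bar>) \<longlonglongrightarrow> \<bar>boltz_mean lam 0 - E\<bar>"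
      by (intro tendsto_intros E)
    then show "\<bar>boltz_mean lam 0 - E\<bar> \<le> C * exp (- \<beta> * (R - r))"
    proof (rule LIMSEQ_le_const2)
      \<comment> \<open>From n >= R on, the truncated half space agrees with the full one on the
        ball of radius R.\<close>
      have "\<bar>boltz_mean lam 0 - boltz_mean (?h n) 0\<bar> \<le> C * exp (- \<beta> * (R - r))" if "n \<ge> nat \<lceil>R\<rceil>" for n
      proof (intro loc act le lam)
        fix x :: 'a assume "norm x < R"
        moreover have "R \<le> real n" using that by linarith
        ultimately show "lam x = ?h n x" by (simp add: lam(3))
      qed
      then show "\<exists>N. \<forall>n\<ge>N. \<bar>boltz_mean lam 0 - boltz_mean (?h n) 0\<bar> \<le> C * exp (- \<beta> * (R - r))" by blast
    qed
  qed
qed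

text \<open>Seen from x, the domain above the slab is a half space at height a with 0 < a <= 1/N,
  not at height 0. Filling the gap inside the ball of radius R restores the exact half space there,
  and removing it again changes the mean by at most exp s - 1.\<close>

lemma boltz_mean_near_half_space:
  assumes l: "0 < l" and u: "norm u = 1" and N: "N > 0"
    and E: "\<And>lam. \<lbrakk>activity lam; \<And>x. lam x \<le> l; \<And>x. norm x < R \<Longrightarrow> lam x = l * indicator {x. u \<bullet> x \<ge> 0} x\<rbrakk>
      \<Longrightarrow> \<bar>boltz_mean lam 0 - E\<bar> \<le> \<delta>"
    and L: "L \<in> sets borel" "bounded L" and x: "ball x R \<subseteq> L"
    and t: "t \<le> u \<bullet> x" "u \<bullet> x < t + 1 / real N"
  shows "\<bar>boltz_mean (\<lambda>y. l * indicator {y \<in> L. t + 1 / real N \<le> u \<bullet> y} y) x - E\<bar>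
     \<le> \<delta> + (exp (l * (measure lborel (ball (0::'a) (R + 1)) / N)) - 1)"
proof -
  let ?A = "{y \<in> L. t + 1 / real N \<le> u \<bullet> y}"
  define a where "a = t + 1 / real N - u \<bullet> x"
  have a: "0 < a" "a \<le> 1 / real N" using t by (auto simp: a_def)
  define A where "A = {y. y + x \<in> ?A}"
  \<comment> \<open>The gap, cut off by the ball so that \<open>measure_slab_le\<close> makes its
    volume of order 1/N.\<close>
  define S where "S = ball (0::'a) R \<inter> {y. 0 \<le> u \<bullet> y \<and> u \<bullet> y < a}"
  define s where "s = l * (measure lborel (ball (0::'a) (R + 1)) / N)"
  have Lm: "?A \<in> sets borel" using L by measurable
  have A: "A \<in> sets borel"
  proof -
    have "(\<lambda>y. y + x) \<in> borel_measurable borel" by measurable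
    from measurable_sets[OF this Lm] show ?thesis by (simp add: A_def vimage_def)
  qed
  have bA: "bounded A"
  proof -
    have "A \<subseteq> (\<lambda>y. y - x) ` L" unfolding A_def by (auto simp: image_iff intro!: bexI[of _ "_ + x"])
    then show ?thesis using bounded_subset bounded_translation_minus L(2) by blast
  qed
  have S: "S \<in> sets borel" unfolding S_def by measurable
  have bS: "bounded S" unfolding S_def by (intro bounded_Int) auto
  have disj: "A \<inter> S = {}" using a by (auto simp: A_def S_def a_def inner_add_right)
  let ?lam = "\<lambda>y. l * indicator (A \<union> S) y :: real"
  have act: "activity ?lam" using A S bA bS l by (intro activity_indicator) auto
  have inA: "y \<in> A \<longleftrightarrow> a \<le> u \<bullet> y" if "norm y < R" for y
  proof -
    have "y + x \<in> L" using that x by (auto simp: dist_norm subset_iff)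
    then show ?thesis by (auto simp: A_def a_def inner_add_right)
  qed
  have "?lam y = l * indicator {x. u \<bullet> x \<ge> 0} y" if "norm y < R" for y
    using inA[OF that] that a by (auto simp: indicator_def S_def)
  then have 1: "\<bar>boltz_mean ?lam 0 - E\<bar> \<le> \<delta>" using l by (intro E act) (auto simp: indicator_def)
  have "measure lborel S \<le> measure lborel (ball (0::'a) R \<inter> {y. 0 \<le> u \<bullet> y \<and> u \<bullet> y < 0 + 1 / real N})"
  proof (rule measure_mono_fmeasurable)
    show "S \<subseteq> ball (0::'a) R \<inter> {y. 0 \<le> u \<bullet> y \<and> u \<bullet> y < 0 + 1 / real N}"
      using a by (auto simp: S_def)
    have "bounded (ball (0::'a) R \<inter> {y. 0 \<le> u \<bullet> y \<and> u \<bullet> y < 0 + 1 / real N})"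
      by (intro bounded_Int) auto
    from bounded_emeasure_lborel[OF this]
    show "ball (0::'a) R \<inter> {y. 0 \<le> u \<bullet> y \<and> u \<bullet> y < 0 + 1 / real N} \<in> fmeasurable lborel"
      by (intro fmeasurableI) auto
  qed (use S in simp)
  also have "\<dots> \<le> measure lborel (ball (0::'a) (R + 1)) / N"
    by (rule measure_slab_le[OF u N])
  finally have mS: "l * measure lborel S \<le> s" unfolding s_def using l by (intro mult_left_mono) auto
  have "(\<integral>\<^sup>+x\<in>S. ?lam x \<partial>lborel) = (\<integral>\<^sup>+x. ennreal l * indicator S x \<partial>lborel)"
    by (intro nn_integral_cong) (auto simp: indicator_def)
  also have "\<dots> = ennreal (l * measure lborel S)"
    using S l bounded_emeasure_lborel[OF bS] by (simp add: nn_integral_cmult_indicator emeasure_eq_ennreal_measure ennreal_mult)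
  finally have "(\<integral>\<^sup>+x\<in>S. ?lam x \<partial>lborel) \<le> ennreal s" using mS by (simp add: ennreal_leI)
  moreover have "0 \<le> s" using l by (simp add: s_def)
  ultimately have r1: "\<bar>boltz_mean ?lam 0 - boltz_mean (\<lambda>x. ?lam x * indicator (-S) x) 0\<bar> \<le> exp s - 1"
    by (intro boltz_mean_remove_region activity_finite act S)
  have r2: "(\<lambda>x. ?lam x * indicator (-S) x) = (\<lambda>y. l * indicator ?A (y + x))"
    using disj by (auto simp: fun_eq_iff indicator_def A_def)
  have r3: "boltz_mean (\<lambda>y. l * indicator ?A (y + x)) 0 = boltz_mean (\<lambda>y. l * indicator ?A y) x"
  proof (rule boltz_mean_translate[of "\<lambda>y. l * indicator ?A y"])
    have "bounded ?A" by (rule bounded_subset[OF L(2)]) auto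
    then show "finite_activity (\<lambda>y. l * indicator ?A y)"
      using Lm l by (intro activity_finite activity_indicator) auto
  qed
  from r1 have "\<bar>boltz_mean ?lam 0 - boltz_mean (\<lambda>y. l * indicator ?A y) x\<bar> \<le> exp s - 1" unfolding r2 r3 .
  then show ?thesis using 1 unfolding s_def by linarith
qed

lemma gibbs_Z_zero: "gibbs_Z \<phi> (\<lambda>_. 0) = 1"
proof -
  have f: "finite_activity (\<lambda>_. 0 :: real)" by (simp add: finite_activity_def)
  have "tuple_integral k (\<lambda>xs. ennreal (list_weight \<phi> (\<lambda>_. 0) xs)) = (if k = 0 then 1 else 0)" for k
  proof (cases k)
    case (Suc m)
    then show ?thesis by (simp add: tuple_integral_def upt_rec)
  qed simp
  then have "partition_sum (\<lambda>_. 0) = (\<Sum>k. if k = 0 then 1 else 0)"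
    unfolding partition_sum_def poisson_sum_def by (intro suminf_cong) auto
  also have "\<dots> = 1" by (subst suminf_finite[of "{0}"]) auto
  finally show ?thesis using partition_sum_eq[OF f] gibbs_Z_ge_1[OF f] by simp
qed

subsection \<open>The pressure\<close>

text \<open>The domain is built up from the empty set by adding slabs downwards along u, so each new
  slab lies below the part already treated. G holds points whose R-ball stays inside L. The error is
  kept proportional to volumes so that it adds up along the induction.\<close>

lemma ln_gibbs_Z_slabs:
  assumes l: "0 < l" and u: "norm u = 1" and N: "N > 0" and E01: "0 \<le> E" "E \<le> 1" and delta: "0 \<le> \<delta>"
    and E: "\<And>lam. \<lbrakk>activity lam; \<And>x. lam x \<le> l; \<And>x. norm x < R \<Longrightarrow> lam x = l * indicator {x. u \<bullet> x \<ge> 0} x\<rbrakk>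
      \<Longrightarrow> \<bar>boltz_mean lam 0 - E\<bar> \<le> \<delta>"
    and L: "L \<in> sets borel" "L \<subseteq> ball 0 (real T)"
    and G: "G \<in> sets borel" "\<And>x. x \<in> G \<Longrightarrow> ball x R \<subseteq> L"
    and eta: "\<eta> = \<delta> + (exp (l * (measure lborel (ball (0::'a) (R + 1)) / real N)) - 1)"
    and \<kappa>: "\<kappa> = l * (measure lborel (ball (0::'a) (real T + 1)) / real N)" "\<kappa> \<le> 1"
  shows "\<bar>ln (gibbs_Z \<phi> (\<lambda>x. l * indicator L x)) - l * E * measure lborel L\<bar>
    \<le> l * (\<eta> + \<kappa>) * measure lborel L + l * measure lborel (L - G)"
proof -
  define A where "A = (\<lambda>j::nat. {y \<in> L. real T - real j / real N \<le> u \<bullet> y})"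
  have bL: "bounded L" by (rule bounded_subset[OF bounded_ball L(2)])
  have A: "A j \<in> sets borel" "bounded (A j)" for j
  proof -
    show "A j \<in> sets borel" unfolding A_def using L(1) by measurable
    show "bounded (A j)" by (rule bounded_subset[OF bL]) (auto simp: A_def)
  qed
  have eta0: "0 \<le> \<eta>" using delta l by (auto simp: eta intro!: add_nonneg_nonneg divide_nonneg_nonneg mult_nonneg_nonneg)
  have inner: "\<bar>u \<bullet> y\<bar> < T" if "y \<in> L" for y
    using that L(2) Cauchy_Schwarz_ineq2[of u y] u by auto
  have "\<bar>ln (gibbs_Z \<phi> (\<lambda>x. l * indicator (A j) x)) - l * E * measure lborel (A j)\<bar>
    \<le> l * (\<eta> + \<kappa>) * measure lborel (A j) + l * measure lborel (A j - G)" for j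
  proof (induction j)
    case 0
    have "A 0 = {}" using inner by (force simp: A_def)
    then show ?case by (simp add: gibbs_Z_zero)
  next
    case (Suc j)
    define t where "t = real T - real (Suc j) / N"
    have t: "t + 1 / real N = real T - real j / N" by (simp add: t_def add_divide_distrib)
    define S where "S = {y \<in> L. t \<le> u \<bullet> y \<and> u \<bullet> y < t + 1 / real N}"
    have S: "S \<in> sets borel" "bounded S"
    proof -
      show "S \<in> sets borel" unfolding S_def using L(1) by measurable
      show "bounded S" by (rule bounded_subset[OF bL]) (auto simp: S_def)
    qed
    have Aj: "A j = {y \<in> L. t + 1 / real N \<le> u \<bullet> y}" unfolding t A_def ..
    have un: "A (Suc j) = A j \<union> S" 
    proof -
      have "t \<le> u \<bullet> y" if "t + 1 / real N \<le> u \<bullet> y" for y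
        by (rule order_trans[OF _ that]) simp
      then show ?thesis unfolding Aj S_def by (auto simp: A_def t_def[symmetric] simp del: of_nat_Suc)
    qed
    have disj: "A j \<inter> S = {}" unfolding Aj S_def by auto
    have fin: "emeasure lborel X \<noteq> \<infinity>" if "bounded X" for X :: "'a set" using bounded_emeasure_lborel[OF that] by simp
    have m1: "measure lborel (A (Suc j)) = measure lborel (A j) + measure lborel S"
      unfolding un using A S disj fin by (intro measure_Union) auto
    have m2: "measure lborel (A (Suc j) - G) = measure lborel (A j - G) + measure lborel (S - G)"
    proof -
      have "A (Suc j) - G = (A j - G) \<union> (S - G)" using un by auto
      moreover have "measure lborel \<dots> = measure lborel (A j - G) + measure lborel (S - G)"
        using A S disj fin[OF bounded_diff[OF A(2)]] fin[OF bounded_diff[OF S(2)]] G by (intro measure_Union) auto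
      ultimately show ?thesis by simp
    qed
    have "measure lborel S \<le> measure lborel (ball (0::'a) (real T) \<inter> {y. t \<le> u \<bullet> y \<and> u \<bullet> y < t + 1 / real N})"
    proof (rule measure_mono_fmeasurable)
      show "S \<subseteq> ball (0::'a) (real T) \<inter> {y. t \<le> u \<bullet> y \<and> u \<bullet> y < t + 1 / real N}"
        using L(2) by (auto simp: S_def)
      have "bounded (ball (0::'a) (real T) \<inter> {y. t \<le> u \<bullet> y \<and> u \<bullet> y < t + 1 / real N})"
        by (intro bounded_Int) auto
      from bounded_emeasure_lborel[OF this]
      show "ball (0::'a) (real T) \<inter> {y. t \<le> u \<bullet> y \<and> u \<bullet> y < t + 1 / real N} \<in> fmeasurable lborel"
        by (intro fmeasurableI) auto
    qed (use S in simp)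
    also have "\<dots> \<le> measure lborel (ball (0::'a) (real T + 1)) / N"
      by (rule measure_slab_le[OF u N])
    finally have mS: "l * measure lborel S \<le> \<kappa>" unfolding \<kappa>(1) using l by (intro mult_left_mono) auto
    have step: "\<bar>ln (gibbs_Z \<phi> (\<lambda>x. l * indicator (A j \<union> S) x)) - ln (gibbs_Z \<phi> (\<lambda>x. l * indicator (A j) x)) - l * E * measure lborel S\<bar>
      \<le> l * \<eta> * measure lborel S + l * measure lborel (S - G) + (l * measure lborel S)\<^sup>2"
    proof (rule ln_gibbs_Z_step[OF l A S disj G(1) E01 eta0])
      show "l * measure lborel S \<le> 1" using mS \<kappa>(2) by simp
      fix x assume x: "x \<in> S \<inter> G"
      show "\<bar>boltz_mean (\<lambda>x. l * indicator (A j) x) x - E\<bar> \<le> \<eta>"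
        unfolding Aj eta using x G(2)[of x] by (intro boltz_mean_near_half_space[OF l u N E L(1) bL]) (auto simp: S_def)
    qed
    \<comment> \<open>One factor of the square is replaced by the uniform bound \<kappa>, which
      makes the quadratic errors additive in the volume.\<close>
    have "(l * measure lborel S)\<^sup>2 \<le> \<kappa> * (l * measure lborel S)"
      unfolding power2_eq_square using mS l by (intro mult_right_mono) auto
    with step Suc.IH show ?case
      unfolding m1 m2 un[symmetric] by (simp add: algebra_simps abs_le_iff)
  qed
  \<comment> \<open>On L the height along u is strictly between -T and T: nothing lies at height T,
    where the induction starts, and 2 T N slabs of width 1/N exhaust L.\<close>
  from this[of "2 * T * N"] have *: "\<bar>ln (gibbs_Z \<phi> (\<lambda>x. l * indicator (A (2 * T * N)) x)) - l * E * measure lborel (A (2 * T * N))\<bar>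
    \<le> l * (\<eta> + \<kappa>) * measure lborel (A (2 * T * N)) + l * measure lborel (A (2 * T * N) - G)" .
  have "A (2 * T * N) = L"
    unfolding A_def using inner N by (force simp: abs_less_iff)
  with * show ?thesis by simp
qed

text \<open>The three e come from mixing at distance R, from the gap up to the half space, and from
  the quadratic slab errors; the last term is the share of the box outside the inner box. N is
  chosen inside the proof, for the given n.\<close>

lemma pressure_seq_near:
  assumes l: "0 < l" and u: "norm u = 1" and E01: "0 \<le> E" "E \<le> 1" and e: "0 < e" "e \<le> 1"
    and E: "\<And>lam. \<lbrakk>activity lam; \<And>x. lam x \<le> l; \<And>x. norm x < real R \<Longrightarrow> lam x = l * indicator {x. u \<bullet> x \<ge> 0} x\<rbrakk>
      \<Longrightarrow> \<bar>boltz_mean lam 0 - E\<bar> \<le> e"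
    and n: "R < n"
  shows "\<bar>pressure_seq \<phi> l n - l * E\<bar> \<le> l * (3 * e) + l * (1 - (real (n - R) / real n) ^ DIM('a))"
proof -
  let ?L = "box_n n :: 'a set" and ?G = "box_n (n - R) :: 'a set"
  have LG: "?L \<in> sets borel" "?G \<in> sets borel" "bounded ?L" by (auto simp: box_n_def bounded_cbox)
  obtain T0 where T0: "?L \<subseteq> ball 0 T0" using bounded_subset_ballD[OF LG(3), of 0] by auto
  define T where "T = nat \<lceil>T0\<rceil>"
  have "T0 \<le> real T" unfolding T_def by linarith
  then have T: "?L \<subseteq> ball 0 (real T)" using T0 subset_ball by blast
  obtain N where N: "N > 0" "exp (l * (measure lborel (ball (0::'a) (real R + 1)) / real N)) - 1 \<le> e"
      "l * (measure lborel (ball (0::'a) (real T + 1)) / real N) \<le> e"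
    by (rule fine_mesh[OF e(1)])
  define \<eta> where "\<eta> = e + (exp (l * (measure lborel (ball (0::'a) (real R + 1)) / real N)) - 1)"
  define \<kappa> where "\<kappa> = l * (measure lborel (ball (0::'a) (real T + 1)) / real N)"
  have small: "\<eta> + \<kappa> \<le> 3 * e" "\<kappa> \<le> 1" unfolding \<eta>_def \<kappa>_def using N e by linarith+
  define m where "m = measure lborel ?L"
  have m: "0 < m" "m = (2 * real n) ^ DIM('a)" using n by (auto simp: m_def measure_box_n)
  have G: "ball x (real R) \<subseteq> ?L" if "x \<in> ?G" for x
    using that n by (intro ball_subset_box_n[of x "n - R"]) auto
  have sub: "?G \<subseteq> ?L" unfolding box_n_def using n by (intro subset_box_imp) auto
  have "measure lborel (?L - ?G) = m - measure lborel ?G"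
    unfolding m_def using sub bounded_emeasure_lborel[OF LG(3)] LG by (intro measure_Diff) auto
  moreover have "measure lborel ?G = m * (real (n - R) / real n) ^ DIM('a)"
    unfolding measure_box_n m(2) power_mult_distrib[symmetric] using n by simp
  ultimately have LGm: "measure lborel (?L - ?G) = m * (1 - (real (n - R) / real n) ^ DIM('a))"
    by (simp add: algebra_simps)
  have "\<bar>ln (gibbs_Z \<phi> (\<lambda>x. l * indicator ?L x)) - l * E * m\<bar> \<le> l * (\<eta> + \<kappa>) * m + l * measure lborel (?L - ?G)"
    unfolding m_def
    by (rule ln_gibbs_Z_slabs[OF l u N(1) E01 _ E LG(1) T LG(2) G \<eta>_def \<kappa>_def small(2)]) (use e in auto)
  also have "\<dots> \<le> l * (3 * e) * m + l * measure lborel (?L - ?G)"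
    using small l m by (intro add_right_mono mult_right_mono mult_left_mono) auto
  also have "\<dots> = (l * (3 * e) + l * (1 - (real (n - R) / real n) ^ DIM('a))) * m"
    unfolding LGm by (simp add: algebra_simps)
  finally have "\<bar>ln (gibbs_Z \<phi> (\<lambda>x. l * indicator ?L x)) - l * E * m\<bar> / m
     \<le> l * (3 * e) + l * (1 - (real (n - R) / real n) ^ DIM('a))"
    using m by (simp add: pos_divide_le_eq)
  moreover have "\<bar>ln (gibbs_Z \<phi> (\<lambda>x. l * indicator ?L x)) - l * E * m\<bar> / m = \<bar>pressure_seq \<phi> l n - l * E\<bar>"
    using m(1) unfolding pressure_seq_def m_def[symmetric]
    by (subst abs_of_pos[OF m(1), symmetric], subst abs_divide[symmetric]) (simp add: diff_divide_distrib)
  ultimately show ?thesis by simp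
qed

text \<open>Mixing fixes R for a given accuracy; after that only the share of the boundary layer
  depends on n, and it tends to 0.\<close>

lemma pressure_seq_tendsto:
  assumes l: "0 < l" and u: "norm u = 1" and E01: "0 \<le> E" "E \<le> 1" and C: "0 < C" "0 < \<beta>"
    and E: "\<And>lam R. \<lbrakk>activity lam; \<And>x. lam x \<le> l; \<And>x. norm x < R \<Longrightarrow> lam x = l * indicator {x. u \<bullet> x \<ge> 0} x\<rbrakk>
      \<Longrightarrow> \<bar>boltz_mean lam 0 - E\<bar> \<le> C * exp (- \<beta> * (R - r))"
  shows "pressure_seq \<phi> l \<longlonglongrightarrow> l * E"
proof (rule LIMSEQ_I)
  fix e' :: real assume e': "0 < e'"
  \<comment> \<open>Four shares of e: three from \<open>pressure_seq_near\<close> and one for the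
    boundary layer.\<close>
  define e where "e = min 1 (e' / (4 * l))"
  have e: "0 < e" "e \<le> 1" "l * (4 * e) \<le> e'"
    using e' l by (auto simp: e_def min_def field_simps)
  obtain R where R: "C * exp (- \<beta> * (real R - r)) \<le> e"
  proof -
    \<comment> \<open>Solves the decay condition for R; the absolute value covers both signs of ln
      (e / C).\<close>
    obtain R :: nat where "r + \<bar>ln (e / C)\<bar> / \<beta> \<le> real R" using real_arch_simple by blast
    then have "\<bar>ln (e / C)\<bar> \<le> \<beta> * (real R - r)" using C by (simp add: field_simps)
    then have "- \<beta> * (real R - r) \<le> ln (e / C)" by (simp add: abs_le_iff)
    then have "exp (- \<beta> * (real R - r)) \<le> e / C"
      using C e by (metis divide_pos_pos exp_le_cancel_iff exp_ln)
    then show ?thesis using C by (intro that[of R]) (simp add: field_simps)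
  qed
  have lim: "(\<lambda>n. 1 - (real (n - R) / real n) ^ DIM('a)) \<longlonglongrightarrow> 0"
  proof -
    have "(\<lambda>n. 1 - (1 - real R / real n) ^ DIM('a)) \<longlonglongrightarrow> 1 - (1 - 0) ^ DIM('a)"
      by (intro tendsto_intros lim_const_over_n)
    moreover have "\<forall>\<^sub>F n in sequentially. 1 - (1 - real R / real n) ^ DIM('a) = 1 - (real (n - R) / real n) ^ DIM('a)"
      using eventually_gt_at_top[of R] by eventually_elim (simp add: of_nat_diff diff_divide_distrib)
    ultimately show ?thesis by (subst tendsto_cong[symmetric]) auto
  qed
  have "\<forall>\<^sub>F n in sequentially. norm (pressure_seq \<phi> l n - l * E) < e'"
    using eventually_gt_at_top[of R] order_tendstoD(2)[OF lim e(1)]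
  proof eventually_elim
    case (elim n)
    have "\<bar>pressure_seq \<phi> l n - l * E\<bar> \<le> l * (3 * e) + l * (1 - (real (n - R) / real n) ^ DIM('a))"
    proof (rule pressure_seq_near[OF l u E01 e(1,2) _ elim(1)])
      fix lam assume "activity lam" "\<And>x. lam x \<le> l" "\<And>x. norm x < real R \<Longrightarrow> lam x = l * indicator {x. u \<bullet> x \<ge> 0} x"
      from E[of lam "real R", OF this] R show "\<bar>boltz_mean lam 0 - E\<bar> \<le> e" by linarith
    qed
    also have "\<dots> < l * (3 * e) + l * e" using elim(2) l by simp
    also have "\<dots> \<le> e'" using e(3) by (simp add: algebra_simps)
    finally show ?case by simp
  qed
  then show "\<exists>no. \<forall>n\<ge>no. norm (pressure_seq \<phi> l n - l * E) < e'"
    by (simp add: eventually_sequentially)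
qed

end

theorem theorem3:
  fixes \<phi> :: "'a::euclidean_space \<Rightarrow> ereal" and l :: real and u :: 'a
  assumes "repulsive_finite_range \<phi>"
    and "l > 0"
    and "strong_spatial_mixing \<phi> l"
    and "norm u = 1"
  shows "pressure_seq \<phi> l \<longlonglongrightarrow> pressure \<phi> l
    \<and> (\<lambda>n::nat. rho \<phi> (\<lambda>x. l * indicator {x. u \<bullet> x \<ge> 0} x * indicator (ball 0 (real n)) x) 0)
        \<longlonglongrightarrow> pressure \<phi> l"
proof -
  interpret pair_potential \<phi> by standard (rule assms(1))
  let ?h = "\<lambda>(n::nat) x. l * indicator {x. u \<bullet> x \<ge> 0} x * indicator (ball 0 (real n)) x"
  obtain E C \<beta> r where E: "0 \<le> E" "E \<le> 1" "0 < C" "0 < \<beta>"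
    and lim: "(\<lambda>n. boltz_mean (?h n) 0) \<longlonglongrightarrow> E"
    and near: "\<And>lam R. \<lbrakk>activity lam; \<And>x. lam x \<le> l; \<And>x. norm x < R \<Longrightarrow> lam x = l * indicator {x. u \<bullet> x \<ge> 0} x\<rbrakk>
      \<Longrightarrow> \<bar>boltz_mean lam 0 - E\<bar> \<le> C * exp (- \<beta> * (R - r))"
    by (rule half_space_limit[OF assms(3,2), of u]) blast
  have p: "pressure_seq \<phi> l \<longlonglongrightarrow> l * E"
    by (rule pressure_seq_tendsto[OF assms(2,4) E near])
  have "(\<lambda>n. l * boltz_mean (?h n) 0) \<longlonglongrightarrow> l * E"
    by (intro tendsto_intros lim)
  \<comment> \<open>At n = 0 the ball is empty and the activity vanishes at the origin; for n > 0 it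
    equals l there, since the origin lies on the boundary of the closed half space.\<close>
  moreover have "\<forall>\<^sub>F n in sequentially. l * boltz_mean (?h n) 0 = rho \<phi> (?h n) 0"
    using eventually_gt_at_top[of 0] by eventually_elim (simp add: rho_eq_boltz_mean)
  ultimately have "(\<lambda>n. rho \<phi> (?h n) 0) \<longlonglongrightarrow> l * E"
    by (subst tendsto_cong[symmetric]) auto
  moreover have "pressure \<phi> l = l * E"
    unfolding pressure_def by (rule limI[OF p])
  ultimately show ?thesis using p by simp
qed

end
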